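(* Let $(X,\mathcal F)$ be a compact Polish foliated space. For each $\mathcal F$-minimal set $Y$ and every leaf $L$, let $\nu_YL=\{\mathbf e\in\nu L\mid\lim_{\mathbf e}L=Y\}$, where $\nu L$ is the Higson corona of $L$. Then, for any leaf $L$, the set $\bigcup_Y\mathrm{Int}_{\nu L}(\nu_YL)$, where $Y$ runs in the family of $\mathcal F$-minimal sets and $\mathrm{Int}_{\nu L}$ denotes the interior in $\nu L$, is dense in $\nu L$.
   Context: Foliated spaces. A (topological) foliated structure $\mathcal F$ of dimension $n$ on a space $X$ is given by an atlas $\{(U_i,\phi_i)\}$, where $\{U_i\}$ is an open cover of $X$ and $\phi_i:U_i\to B_i\times Z_i$ are homeomorphisms, with $B_i\subset\mathbb R^n$ an open ball and $Z_i$ a locally compact Polish space, whose changes of coordinates are locally of the form $\phi_j\phi_i^{-1}(x,z)=(x_{ij}(x,z),h_{ij}(z))$. The sets $\phi_i^{-1}(B_i\times\{z\})$ are the plaques; the leaves are the connected components of $X$ with the (leaf) topology whose basic open sets are the plaques of all foliated charts. $(X,\mathcal F)$ is a compact Polish foliated space if $X$ is compact, Hausdorff and second countable. A subset of $X$ is saturated if it is a union of leaves. An $\mathcal F$-minimal set is a nonempty, saturated, closed subset of $X$ which is minimal (for inclusion) among the sets with these properties. Leaf metrics. A foliated atlas $\mathcal U=\{(U_i,\phi_i)\}$ is regular if: each $(U_i,\phi_i)$ is the restriction of a foliated chart $(\widetilde U_i,\tilde\phi_i)$ with $\overline{U_i}\subset\widetilde U_i$; $\{U_i\}$ is locally finite;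 and the closure of every plaque of $(U_i,\phi_i)$ meets at most the closure of one plaque of $(U_j,\phi_j)$, for all $i,j$. Fix a regular foliated atlas $\mathcal U$. For $x,y$ in the same leaf, $d^*_{\mathcal U}(x,y)=0$ if $x=y$, and otherwise it is the minimum number of $\mathcal U$-plaques whose union is connected and contains $x$ and $y$. Higson compactification. Let $L$ be a leaf with the leaf topology. A function on $L$ vanishes at infinity if for every $\epsilon>0$ its absolute value is $<\epsilon$ outside some compact subset of $L$. For $f:L\to\mathbb C$ and $R>0$, $\mathsf V_Rf(x)=\sup\{|f(x)-f(y)|\mid y\in L,\ d^*_{\mathcal U}(x,y)<R\}$. A bounded function $f$ is a Higson function if $\mathsf V_Rf$ vanishes at infinity for all $R>0$. The Higson compactification $L^\nu$ is the compactification of $L$ corresponding (by Gelfand duality) to the unital closed involutive algebra of bounded Higson functions on $L$ that are continuous for the leaf topology; i.e., $L^\nu$ is a compact Hausdorff space containing $L$ as a dense open subspace, and these are exactly the functions on $L$ with a continuous extension to $L^\nu$. It is independent of $\mathcal U$. The Higson corona is $\nu L=L^\nu\setminus L$. Limit sets. For $\mathbf e\in\nu L$, $\lim_{\mathbf e}L=\bigcap_V\mathrm{Cl}_X(V\cap L)$, where $V$ runs in the collection of neighborhoods of $\mathbf e$ in $L^\nu$. *)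

theory Defs
  imports "HOL-Analysis.Analysis"
begin

section \<open>Foliated charts and atlases\<close>

text \<open>
  \<^term>\<open>Euclidean_space n\<close> is the library's model of \<open>\<real>\<^sup>n\<close> (sequences vanishing from index \<open>n\<close> on);
  it allows every \<open>n :: nat\<close>, including \<open>n = 0\<close>.
\<close>

definition Euclidean_open_ball :: "nat \<Rightarrow> (nat \<Rightarrow> real) \<Rightarrow> real \<Rightarrow> (nat \<Rightarrow> real) set" where
  "Euclidean_open_ball n a r =
     {x \<in> topspace (Euclidean_space n). L2_set (\<lambda>i. x i - a i) {..<n} < r}"

text \<open>
  A chart \<open>\<phi> : U \<rightarrow> B \<times> Z\<close>. The values of \<open>chart_map\<close> outside \<open>chart_dom\<close> are irrelevant.
  All transversals \<open>Z\<close> are topologies carried by subsets of one type \<open>'z\<close>; as \<open>'z\<close> is an arbitrary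
  type, this is no restriction.
\<close>

record ('a, 'z) foliated_chart =
  chart_dom  :: "'a set"
  chart_ball :: "(nat \<Rightarrow> real) set"
  chart_transversal :: "'z topology"
  chart_map  :: "'a \<Rightarrow> (nat \<Rightarrow> real) \<times> 'z"

definition chart_codomain :: "nat \<Rightarrow> ('a, 'z) foliated_chart \<Rightarrow> ((nat \<Rightarrow> real) \<times> 'z) topology" where
  "chart_codomain n c =
     prod_topology (subtopology (Euclidean_space n) (chart_ball c)) (chart_transversal c)"

definition product_chart :: "'a topology \<Rightarrow> nat \<Rightarrow> ('a, 'z) foliated_chart \<Rightarrow> bool" where
  "product_chart X n c \<longleftrightarrow>
     openin X (chart_dom c) \<and>
     (\<exists>a \<in> topspace (Euclidean_space n). \<exists>r > 0. chart_ball c = Euclidean_open_ball n a r) \<and>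
     locally_compact_space (chart_transversal c) \<and>
     completely_metrizable_space (chart_transversal c) \<and>
     second_countable (chart_transversal c) \<and>
     homeomorphic_map (subtopology X (chart_dom c)) (chart_codomain n c) (chart_map c)"

text \<open>
  The change of coordinates from \<open>c\<close> to \<open>c'\<close> is locally of the form \<open>(x, z) \<mapsto> (g (x, z), h z)\<close>.
\<close>

definition foliated_coordinate_change ::
    "nat \<Rightarrow> ('a, 'z) foliated_chart \<Rightarrow> ('a, 'z) foliated_chart \<Rightarrow> bool" where
  "foliated_coordinate_change n c c' \<longleftrightarrow>
     (\<forall>p \<in> chart_map c ` (chart_dom c \<inter> chart_dom c').
        \<exists>N g h. openin (chart_codomain n c) N \<and> p \<in> N \<and>
          N \<subseteq> chart_map c ` (chart_dom c \<inter> chart_dom c') \<and>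
          (\<forall>(x, z) \<in> N. chart_map c' (inv_into (chart_dom c) (chart_map c) (x, z)) = (g (x, z), h z)))"

definition foliated_atlas :: "'a topology \<Rightarrow> nat \<Rightarrow> ('a, 'z) foliated_chart set \<Rightarrow> bool" where
  "foliated_atlas X n \<A> \<longleftrightarrow>
     (\<forall>c \<in> \<A>. product_chart X n c) \<and>
     (\<Union>c \<in> \<A>. chart_dom c) = topspace X \<and>
     (\<forall>c \<in> \<A>. \<forall>c' \<in> \<A>. foliated_coordinate_change n c c')"

text \<open>
  The foliated structure \<open>\<F>\<close> on \<open>X\<close> is given by an atlas \<open>\<A>\<close>. All foliated charts of \<open>\<F>\<close>, i.e. the
  maximal atlas containing \<open>\<A>\<close>:
\<close>

definition foliated_charts ::
    "'a topology \<Rightarrow> nat \<Rightarrow> ('a, 'z) foliated_chart set \<Rightarrow> ('a, 'z) foliated_chart set" where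
  "foliated_charts X n \<A> =
     {c. product_chart X n c \<and>
         (\<forall>c' \<in> \<A>. foliated_coordinate_change n c c' \<and> foliated_coordinate_change n c' c)}"

definition compact_Polish_foliated_space ::
    "'a topology \<Rightarrow> nat \<Rightarrow> ('a, 'z) foliated_chart set \<Rightarrow> bool" where
  "compact_Polish_foliated_space X n \<A> \<longleftrightarrow>
     compact_space X \<and> Hausdorff_space X \<and> second_countable X \<and> foliated_atlas X n \<A>"

section \<open>Leaves and minimal sets\<close>

definition plaques :: "('a, 'z) foliated_chart \<Rightarrow> 'a set set" where
  "plaques c =
     {{x \<in> chart_dom c. chart_map c x \<in> chart_ball c \<times> {z}} | z. z \<in> topspace (chart_transversal c)}"

text \<open>
  It is essential to use the plaques of all foliated charts here: those of a single atlas need not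
  form a base of the leaf topology.
\<close>

definition leaf_topology :: "'a topology \<Rightarrow> nat \<Rightarrow> ('a, 'z) foliated_chart set \<Rightarrow> 'a topology" where
  "leaf_topology X n \<A> = topology_generated_by (\<Union>c \<in> foliated_charts X n \<A>. plaques c)"

definition leaves :: "'a topology \<Rightarrow> nat \<Rightarrow> ('a, 'z) foliated_chart set \<Rightarrow> 'a set set" where
  "leaves X n \<A> = connected_components_of (leaf_topology X n \<A>)"

definition saturated :: "'a topology \<Rightarrow> nat \<Rightarrow> ('a, 'z) foliated_chart set \<Rightarrow> 'a set \<Rightarrow> bool" where
  "saturated X n \<A> S \<longleftrightarrow> (\<exists>\<L> \<subseteq> leaves X n \<A>. S = \<Union>\<L>)"

definition minimal_sets :: "'a topology \<Rightarrow> nat \<Rightarrow> ('a, 'z) foliated_chart set \<Rightarrow> 'a set set" where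
  "minimal_sets X n \<A> =
     {Y. Y \<noteq> {} \<and> saturated X n \<A> Y \<and> closedin X Y \<and>
         (\<forall>Y'. Y' \<noteq> {} \<and> saturated X n \<A> Y' \<and> closedin X Y' \<and> Y' \<subseteq> Y \<longrightarrow> Y' = Y)}"

section \<open>Regular atlases and leaf metrics\<close>

definition chart_restriction :: "('a, 'z) foliated_chart \<Rightarrow> ('a, 'z) foliated_chart \<Rightarrow> bool" where
  "chart_restriction c c' \<longleftrightarrow>
     chart_dom c \<subseteq> chart_dom c' \<and> (\<forall>x \<in> chart_dom c. chart_map c x = chart_map c' x)"

definition regular_foliated_atlas ::
    "'a topology \<Rightarrow> nat \<Rightarrow> ('a, 'z) foliated_chart set \<Rightarrow> ('a, 'z) foliated_chart set \<Rightarrow> bool" where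
  "regular_foliated_atlas X n \<A> \<U> \<longleftrightarrow>
     \<U> \<subseteq> foliated_charts X n \<A> \<and> (\<Union>c \<in> \<U>. chart_dom c) = topspace X \<and>
     (\<forall>c \<in> \<U>. \<exists>c' \<in> foliated_charts X n \<A>.
        chart_restriction c c' \<and> X closure_of (chart_dom c) \<subseteq> chart_dom c') \<and>
     (\<forall>x \<in> topspace X. \<exists>V. openin X V \<and> x \<in> V \<and> finite {c \<in> \<U>. chart_dom c \<inter> V \<noteq> {}}) \<and>
     (\<forall>c \<in> \<U>. \<forall>c' \<in> \<U>. \<forall>P \<in> plaques c. \<forall>Q \<in> plaques c'. \<forall>Q' \<in> plaques c'.
        X closure_of P \<inter> X closure_of Q \<noteq> {} \<and> X closure_of P \<inter> X closure_of Q' \<noteq> {} \<longrightarrow> Q = Q')"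

text \<open>
  The metric \<open>d\<^sup>*\<close> of \<open>\<U>\<close>; only meaningful for \<open>x\<close> and \<open>y\<close> in the same leaf. Connectedness is meant in
  the leaf topology.
\<close>

definition plaque_dist ::
    "'a topology \<Rightarrow> nat \<Rightarrow> ('a, 'z) foliated_chart set \<Rightarrow> ('a, 'z) foliated_chart set \<Rightarrow> 'a \<Rightarrow> 'a \<Rightarrow> nat" where
  "plaque_dist X n \<A> \<U> x y =
     (if x = y then 0
      else (LEAST k. \<exists>\<P> \<subseteq> (\<Union>c \<in> \<U>. plaques c). finite \<P> \<and> card \<P> = k \<and>
              connectedin (leaf_topology X n \<A>) (\<Union>\<P>) \<and> x \<in> \<Union>\<P> \<and> y \<in> \<Union>\<P>))"

section \<open>Higson compactification\<close>

definition vanishes_at_infinity :: "'a topology \<Rightarrow> ('a \<Rightarrow> real) \<Rightarrow> bool" where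
  "vanishes_at_infinity T g \<longleftrightarrow>
     (\<forall>\<epsilon> > 0. \<exists>K. compactin T K \<and> (\<forall>x \<in> topspace T - K. \<bar>g x\<bar> < \<epsilon>))"

definition leaf_variation ::
    "'a topology \<Rightarrow> nat \<Rightarrow> ('a, 'z) foliated_chart set \<Rightarrow> ('a, 'z) foliated_chart set \<Rightarrow> 'a set \<Rightarrow>
     real \<Rightarrow> ('a \<Rightarrow> complex) \<Rightarrow> 'a \<Rightarrow> real" where
  "leaf_variation X n \<A> \<U> L R f x =
     Sup {cmod (f x - f y) | y. y \<in> L \<and> real (plaque_dist X n \<A> \<U> x y) < R}"

definition Higson_function ::
    "'a topology \<Rightarrow> nat \<Rightarrow> ('a, 'z) foliated_chart set \<Rightarrow> ('a, 'z) foliated_chart set \<Rightarrow> 'a set \<Rightarrow>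
     ('a \<Rightarrow> complex) \<Rightarrow> bool" where
  "Higson_function X n \<A> \<U> L f \<longleftrightarrow>
     bounded (f ` L) \<and>
     (\<forall>R > 0. vanishes_at_infinity (subtopology (leaf_topology X n \<A>) L) (leaf_variation X n \<A> \<U> L R f))"

text \<open>
  \<open>K\<close>, with the inclusion \<open>\<iota>\<close> of \<open>L\<close>, is the Higson compactification of \<open>L\<close>. By Gelfand duality the
  conditions determine the pair up to a unique homeomorphism commuting with the inclusions.
\<close>

definition Higson_compactification ::
    "'a topology \<Rightarrow> nat \<Rightarrow> ('a, 'z) foliated_chart set \<Rightarrow> ('a, 'z) foliated_chart set \<Rightarrow> 'a set \<Rightarrow>
     'k topology \<Rightarrow> ('a \<Rightarrow> 'k) \<Rightarrow> bool" where
  "Higson_compactification X n \<A> \<U> L K \<iota> \<longleftrightarrow>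
     compact_space K \<and> Hausdorff_space K \<and>
     embedding_map (subtopology (leaf_topology X n \<A>) L) K \<iota> \<and>
     openin K (\<iota> ` L) \<and> K closure_of (\<iota> ` L) = topspace K \<and>
     (\<forall>f :: 'a \<Rightarrow> complex.
        (\<exists>F. continuous_map K euclidean F \<and> (\<forall>x \<in> L. F (\<iota> x) = f x)) \<longleftrightarrow>
        Higson_function X n \<A> \<U> L f \<and>
        continuous_map (subtopology (leaf_topology X n \<A>) L) euclidean f)"

definition corona :: "'a set \<Rightarrow> 'k topology \<Rightarrow> ('a \<Rightarrow> 'k) \<Rightarrow> 'k topology" where
  "corona L K \<iota> = subtopology K (topspace K - \<iota> ` L)"

definition neighborhoods_of :: "'k topology \<Rightarrow> 'k \<Rightarrow> 'k set set" where
  "neighborhoods_of K e = {V. V \<subseteq> topspace K \<and> (\<exists>O'. openin K O' \<and> e \<in> O' \<and> O' \<subseteq> V)}"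

text \<open>The set \<open>V \<inter> L\<close> is \<open>{x \<in> L. \<iota> x \<in> V}\<close>; its closure is taken in \<open>X\<close>.\<close>

definition leaf_limit :: "'a topology \<Rightarrow> 'a set \<Rightarrow> 'k topology \<Rightarrow> ('a \<Rightarrow> 'k) \<Rightarrow> 'k \<Rightarrow> 'a set" where
  "leaf_limit X L K \<iota> e = (\<Inter>V \<in> neighborhoods_of K e. X closure_of {x \<in> L. \<iota> x \<in> V})"

definition corona_limiting_to ::
    "'a topology \<Rightarrow> 'a set \<Rightarrow> 'k topology \<Rightarrow> ('a \<Rightarrow> 'k) \<Rightarrow> 'a set \<Rightarrow> 'k set" where
  "corona_limiting_to X L K \<iota> Y = {e \<in> topspace (corona L K \<iota>). leaf_limit X L K \<iota> e = Y}"

end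

(*
  Let e be a corona point of L and V a neighborhood of e. Its limit set is nonempty, closed and,
  because Higson functions vary slowly, saturated; so it contains a minimal set Y. Since closures of
  plaques are compact, a leaf that comes close enough to Y stays close to it along any given number of
  plaques. Hence there are points y_k of L in V that run to infinity and whose k-neighborhoods in the
  leaf lie in the k-th of a sequence of neighborhoods of Y with intersection Y. Bump functions of height
  1 and slope 1/k around the y_k combine to a continuous Higson function on L. Its extension is positive
  at a cluster point of the y_k, which lies in the corona and in the closure of V; and wherever it is
  positive on the corona, the limit set is contained in Y and therefore equal to Y.
*)
theory Submission
  imports Defs
begin

section \<open>Charts\<close>

text \<open>The statement uses three descriptions of a leaf: connected components of the leaf
  topology, the metric \<open>plaque_dist\<close>, and compact subsets of the leaf. All are reduced
  to one relation, \<open>step\<close>, which joins two points of a common plaque of \<U>: saturated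
  sets are the subsets of the space closed under it, chain length compares with
  \<open>plaque_dist\<close> up to a quadratic bound, and the points of a leaf within k steps of a
  given one lie in a compact set. The Higson property is then checked on powers of
  \<open>step\<close>.

  The combined bump must vary slowly at infinity although infinitely many bumps occur, with supports
  that may overlap. It is a supremum, so slopes do not add up: far from the centres of small index
  only flat bumps are left. Flat bumps are wide, which is why growing neighborhoods of the y_k have
  to stay near Y. Chain length being an integer, the supremum jumps; averaging it with continuous
  weights costs one more plaque of room in the estimates.\<close>

lemma openin_Euclidean_open_ball: "openin (Euclidean_space n) (Euclidean_open_ball n a r)"
proof -
  have "continuous_map (Euclidean_space n) euclideanreal (\<lambda>x. L2_set (\<lambda>i. x i - a i) {..<n})"
    unfolding Euclidean_space_def euclidean_product_topology continuous_map_iff_continuous L2_set_def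
    by (intro continuous_intros continuous_on_subset[OF continuous_on_product_coordinates]) auto
  from openin_continuous_map_preimage[OF this, of "{..<r}"] show ?thesis
    by (simp add: Euclidean_open_ball_def)
qed

lemma center_in_Euclidean_open_ball:
  "a \<in> topspace (Euclidean_space n) \<Longrightarrow> r > 0 \<Longrightarrow> a \<in> Euclidean_open_ball n a r"
  by (simp add: Euclidean_open_ball_def L2_set_def)

text \<open>\<open>Euclidean_space n\<close> carries the topology induced by the product, so an open
  set contains the trace of a box around \<open>a\<close>. Coordinates from \<open>n\<close> on
  vanish on the whole space, hence only finitely many side lengths bound the radius.\<close>

lemma Euclidean_open_ball_within:
  assumes W: "openin (Euclidean_space n) W" and a: "a \<in> W"
  obtains r where "r > 0" "Euclidean_open_ball n a r \<subseteq> W"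
proof -
  obtain W' where W': "open W'" "W = W' \<inter> topspace (Euclidean_space n)"
    using W unfolding Euclidean_space_def euclidean_product_topology openin_subtopology
    by auto
  then have "a \<in> W'" using a by auto
  then obtain U where U: "a \<in> Pi\<^sub>E UNIV U" "\<And>i. open (U i)" "Pi\<^sub>E UNIV U \<subseteq> W'"
    using product_topology_open_contains_basis[of "\<lambda>_. euclidean" UNIV W' a] W'(1)
    unfolding euclidean_product_topology by (auto simp: open_fun_def)
  have "\<forall>i. \<exists>e>0. ball (a i) e \<subseteq> U i"
    using U open_contains_ball by (metis PiE_mem UNIV_I)
  then obtain e where e: "\<And>i. e i > 0" "\<And>i. ball (a i) (e i) \<subseteq> U i" by metis
  \<comment> \<open>The extra element 1 keeps the minimum meaningful for
    \<open>n = 0\<close>.\<close>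
  define r where "r = Min (insert 1 (e ` {..<n}))"
  have r: "r > 0" "\<And>i. i < n \<Longrightarrow> r \<le> e i"
    using e(1) by (auto simp: r_def)
  have "x \<in> W" if x: "x \<in> Euclidean_open_ball n a r" for x
  proof -
    have xs: "x \<in> topspace (Euclidean_space n)" using x by (auto simp: Euclidean_open_ball_def)
    have as: "a \<in> topspace (Euclidean_space n)" using a W'(2) by blast
    have "x i \<in> U i" for i
    proof (cases "i < n")
      case True
      have "\<bar>x i - a i\<bar> \<le> L2_set (\<lambda>i. x i - a i) {..<n}"
        using member_le_L2_set[of "{..<n}" i "\<lambda>i. \<bar>x i - a i\<bar>"] True
        by (auto simp: L2_set_def)
      also have "\<dots> < e i" using x r(2)[OF True] by (auto simp: Euclidean_open_ball_def)
      finally show ?thesis using e(2)[of i] by (auto simp: dist_real_def abs_minus_commute)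
    next
      case False
      then have "x i = a i" using xs as by (auto simp: topspace_Euclidean_space)
      then show ?thesis using e(1)[of i] e(2)[of i] by (metis centre_in_ball subsetD)
    qed
    then have "x \<in> W'" using U(3) by auto
    then show ?thesis using W'(2) xs by auto
  qed
  then show thesis using that[OF r(1)] by blast
qed

text \<open>The ball is star-shaped about its centre: it is a union of segments that all contain
  \<open>a\<close>.\<close>

lemma connectedin_Euclidean_open_ball:
  assumes a: "a \<in> topspace (Euclidean_space n)" and r: "r > 0"
  shows "connectedin (Euclidean_space n) (Euclidean_open_ball n a r)"
proof -
  define seg where "seg x = (\<lambda>t::real. \<lambda>i. (1 - t) * a i + t * x i)" for x :: "nat \<Rightarrow> real"
  let ?B = "Euclidean_open_ball n a r"
  have seg: "connectedin (Euclidean_space n) (seg x ` {0..1})" "seg x ` {0..1} \<subseteq> ?B"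
    "a \<in> seg x ` {0..1}" "x \<in> seg x ` {0..1}" if x: "x \<in> ?B" for x
  proof -
    have xs: "x \<in> topspace (Euclidean_space n)" using x by (auto simp: Euclidean_open_ball_def)
    have sub: "seg x t \<in> topspace (Euclidean_space n)" for t
      using xs a by (auto simp: topspace_Euclidean_space seg_def)
    have "continuous_on {0..1} (seg x)"
      unfolding seg_def by (intro continuous_on_coordinatewise_then_product continuous_intros)
    then have "continuous_map (top_of_set {0..1}) (Euclidean_space n) (seg x)"
      using sub unfolding Euclidean_space_def euclidean_product_topology
      by (auto simp: continuous_map_in_subtopology)
    from connectedin_continuous_map_image[OF this, of "{0..1}"]
    show "connectedin (Euclidean_space n) (seg x ` {0..1})"
      by (simp add: connectedin_subtopology)
    show "seg x ` {0..1} \<subseteq> ?B"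
    proof clarify
      fix t :: real assume t: "t \<in> {0..1}"
      have "L2_set (\<lambda>i. seg x t i - a i) {..<n} = L2_set (\<lambda>i. t * (x i - a i)) {..<n}"
        by (simp add: seg_def algebra_simps)
      also have "\<dots> = t * L2_set (\<lambda>i. x i - a i) {..<n}"
        using t by (subst L2_set_right_distrib) auto
      also have "\<dots> \<le> L2_set (\<lambda>i. x i - a i) {..<n}"
        using t by (intro mult_left_le_one_le) (auto simp: L2_set_nonneg)
      finally show "seg x t \<in> ?B" using x sub by (auto simp: Euclidean_open_ball_def)
    qed
    have "seg x 0 = a" "seg x 1 = x" by (auto simp: seg_def)
    then show "a \<in> seg x ` {0..1}" "x \<in> seg x ` {0..1}"
      by (metis atLeastAtMost_iff imageI order_refl zero_le_one)+
  qed
  have "connectedin (Euclidean_space n) (\<Union>x\<in>?B. seg x ` {0..1})"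
  proof (rule connectedin_Union)
    show "\<Inter> ((\<lambda>x. seg x ` {0..1}) ` ?B) \<noteq> {}"
      using seg(3) by blast
  qed (use seg(1) in blast)
  moreover have "(\<Union>x\<in>?B. seg x ` {0..1}) = ?B"
    using seg(2,4) by (intro equalityI UN_least subsetI UN_I) auto
  ultimately show ?thesis by simp
qed

section \<open>Plaques as fibres of the transversal coordinate\<close>

definition transversal_coord :: "('a, 'z) foliated_chart \<Rightarrow> 'a \<Rightarrow> 'z" where
  "transversal_coord c x = snd (chart_map c x)"

text \<open>Plaques are labelled by a point instead of a transversal value, which gives direct
  access to the plaque through \<open>x\<close>. Meant for \<open>x\<close> in the domain of
  \<open>c\<close>.\<close>

definition plaque_at :: "('a, 'z) foliated_chart \<Rightarrow> 'a \<Rightarrow> 'a set" where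
  "plaque_at c x = {y \<in> chart_dom c. transversal_coord c y = transversal_coord c x}"

context
  fixes X :: "'a topology" and n :: nat and c :: "('a, 'z) foliated_chart"
  assumes c: "product_chart X n c"
begin

lemma product_chart_dom: "openin X (chart_dom c)" "chart_dom c \<subseteq> topspace X"
  using c openin_subset by (auto simp: product_chart_def)

lemma product_chart_homeomorphic:
  "homeomorphic_map (subtopology X (chart_dom c)) (chart_codomain n c) (chart_map c)"
  using c by (auto simp: product_chart_def)

lemma product_chart_ball:
  obtains a r where "a \<in> topspace (Euclidean_space n)" "r > 0" "chart_ball c = Euclidean_open_ball n a r"
  using c by (auto simp: product_chart_def)

lemma topspace_chart_codomain:
  "topspace (chart_codomain n c) = chart_ball c \<times> topspace (chart_transversal c)"
proof -
  have "chart_ball c \<subseteq> topspace (Euclidean_space n)"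
    by (rule product_chart_ball) (auto simp: Euclidean_open_ball_def)
  then show ?thesis by (auto simp: chart_codomain_def)
qed

lemma product_chart_image:
  "chart_map c ` chart_dom c = chart_ball c \<times> topspace (chart_transversal c)"
  using homeomorphic_imp_surjective_map[OF product_chart_homeomorphic] product_chart_dom(2)
  by (simp add: topspace_chart_codomain Int_absorb1)

lemma chart_map_in: "x \<in> chart_dom c \<Longrightarrow> chart_map c x \<in> chart_ball c \<times> topspace (chart_transversal c)"
  using product_chart_image by blast

lemma product_chart_inj: "inj_on (chart_map c) (chart_dom c)"
  using homeomorphic_imp_injective_map[OF product_chart_homeomorphic] product_chart_dom(2)
  by (simp add: Int_absorb1)

lemma product_chart_Hausdorff: "Hausdorff_space (chart_transversal c)"
  using c completely_metrizable_imp_metrizable_space metrizable_imp_Hausdorff_space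
  by (auto simp: product_chart_def)

lemma continuous_transversal_coord:
  "continuous_map (subtopology X (chart_dom c)) (chart_transversal c) (transversal_coord c)"
  using continuous_map_compose[OF homeomorphic_imp_continuous_map[OF product_chart_homeomorphic],
      of "chart_transversal c" snd]
  by (simp add: chart_codomain_def o_def transversal_coord_def[abs_def] continuous_map_snd)

lemma transversal_coord_in: "x \<in> chart_dom c \<Longrightarrow> transversal_coord c x \<in> topspace (chart_transversal c)"
  using chart_map_in by (auto simp: transversal_coord_def mem_Times_iff)

text \<open>The ball is nonempty, so every transversal value is attained; hence every plaque is
  nonempty and can be labelled by one of its points.\<close>

lemma plaques_eq: "plaques c = plaque_at c ` chart_dom c"
proof -
  have *: "{x \<in> chart_dom c. chart_map c x \<in> chart_ball c \<times> {z}} = {x \<in> chart_dom c. transversal_coord c x = z}" for z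
    using chart_map_in by (auto simp: transversal_coord_def mem_Times_iff)
  obtain a where a: "a \<in> chart_ball c"
  proof (rule product_chart_ball)
    fix a r assume "a \<in> topspace (Euclidean_space n)" "r > 0" "chart_ball c = Euclidean_open_ball n a r"
    then show thesis using that[of a] center_in_Euclidean_open_ball[of a n r] by simp
  qed
  have "\<exists>x\<in>chart_dom c. transversal_coord c x = z" if "z \<in> topspace (chart_transversal c)" for z
  proof -
    have "(a, z) \<in> chart_map c ` chart_dom c" using product_chart_image a that by auto
    then obtain x where "x \<in> chart_dom c" "chart_map c x = (a, z)" by (metis imageE)
    then show ?thesis by (auto simp: transversal_coord_def intro!: bexI[of _ x])
  qed
  then have "topspace (chart_transversal c) = transversal_coord c ` chart_dom c"
    using transversal_coord_in by blast
  then show ?thesis unfolding plaques_def * by (auto simp: plaque_at_def image_iff)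
qed

lemma chart_map_plaque_at:
  assumes "x \<in> chart_dom c"
  shows "chart_map c ` plaque_at c x = chart_ball c \<times> {transversal_coord c x}"
proof (intro equalityI subsetI)
  fix p assume "p \<in> chart_map c ` plaque_at c x"
  then obtain y where y: "y \<in> plaque_at c x" "p = chart_map c y" by blast
  then have "y \<in> chart_dom c" "snd p = transversal_coord c x"
    by (simp_all add: plaque_at_def transversal_coord_def)
  then show "p \<in> chart_ball c \<times> {transversal_coord c x}"
    using chart_map_in[of y] y(2) by (simp add: mem_Times_iff)
next
  fix p assume p: "p \<in> chart_ball c \<times> {transversal_coord c x}"
  then have "p \<in> chart_map c ` chart_dom c"
    using product_chart_image transversal_coord_in[OF assms] by (simp add: mem_Times_iff)
  then obtain y where "y \<in> chart_dom c" "p = chart_map c y" by blast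
  with p show "p \<in> chart_map c ` plaque_at c x"
    by (intro image_eqI[of _ _ y]) (simp_all add: plaque_at_def transversal_coord_def mem_Times_iff)
qed

lemma connectedin_plaque_at:
  assumes "x \<in> chart_dom c"
  shows "connectedin X (plaque_at c x)"
proof -
  have ball: "connectedin (Euclidean_space n) (chart_ball c)"
    by (rule product_chart_ball) (simp add: connectedin_Euclidean_open_ball)
  have "connectedin (chart_codomain n c) (chart_ball c \<times> {transversal_coord c x})"
    unfolding chart_codomain_def connectedin_Times connectedin_subtopology
    using ball transversal_coord_in[OF assms] by simp
  moreover have "plaque_at c x \<subseteq> topspace (subtopology X (chart_dom c))"
    using product_chart_dom(2) by (simp add: plaque_at_def subset_iff)
  ultimately have "connectedin (subtopology X (chart_dom c)) (plaque_at c x)"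
    using homeomorphic_map_connectedness[OF product_chart_homeomorphic] chart_map_plaque_at[OF assms]
    by metis
  then show ?thesis by (simp only: connectedin_subtopology)
qed

text \<open>The transversal coordinate is an open map.\<close>

lemma plaque_at_meets_nearby:
  assumes y: "y \<in> plaque_at c x" and N: "openin X N" "y \<in> N" and x: "x \<in> chart_dom c"
  obtains M where "openin X M" "x \<in> M" "M \<subseteq> chart_dom c" "\<And>x'. x' \<in> M \<Longrightarrow> plaque_at c x' \<inter> N \<noteq> {}"
proof -
  let ?T = "transversal_coord c"
  have yd: "y \<in> chart_dom c" "?T y = ?T x" using y by (auto simp: plaque_at_def)
  have sub: "chart_dom c \<inter> N \<subseteq> topspace (subtopology X (chart_dom c))"
    using product_chart_dom by auto
  have "openin (subtopology X (chart_dom c)) (chart_dom c \<inter> N)"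
    using N by (simp add: openin_subtopology_Int2)
  then have "openin (chart_codomain n c) (chart_map c ` (chart_dom c \<inter> N))"
    using homeomorphic_map_openness[OF product_chart_homeomorphic sub] by simp
  then have "openin (chart_transversal c) (snd ` chart_map c ` (chart_dom c \<inter> N))"
    unfolding chart_codomain_def using open_map_snd[unfolded open_map_def] by blast
  then have o: "openin (chart_transversal c) (?T ` (chart_dom c \<inter> N))"
    by (simp add: image_image transversal_coord_def)
  let ?M = "{x' \<in> topspace (subtopology X (chart_dom c)). ?T x' \<in> ?T ` (chart_dom c \<inter> N)}"
  have "openin (subtopology X (chart_dom c)) ?M"
    using openin_continuous_map_preimage[OF continuous_transversal_coord o] .
  then have "openin X ?M" using product_chart_dom by (simp add: openin_open_subtopology)
  moreover have "?T x \<in> ?T ` (chart_dom c \<inter> N)" using yd N by (intro image_eqI[of _ _ y]) auto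
  moreover have "plaque_at c x' \<inter> N \<noteq> {}" if "x' \<in> ?M" for x'
    using that by (auto simp: plaque_at_def)
  ultimately show thesis using that[of ?M] x product_chart_dom(2) by auto
qed

end

section \<open>Coordinate changes and restricted charts\<close>

text \<open>On the preimage \<open>M\<close> of the neighborhood \<open>N\<close>, the map
  \<open>h\<close> expresses the transversal coordinate of \<open>c'\<close> through that of
  \<open>c\<close>. This is only local: the plaques of \<open>c\<close> and \<open>c'\<close>
  through \<open>x\<close> may differ away from \<open>M\<close>.\<close>

lemma coordinate_change_locally_constant:
  assumes c: "product_chart X n c" and cc': "foliated_coordinate_change n c c'"
    and x: "x \<in> chart_dom c" "x \<in> chart_dom c'"
  obtains M where "openin X M" "x \<in> M" "M \<subseteq> chart_dom c \<inter> chart_dom c'"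
    "\<And>y. y \<in> M \<Longrightarrow> transversal_coord c y = transversal_coord c x \<Longrightarrow>
      transversal_coord c' y = transversal_coord c' x"
proof -
  note inj = product_chart_inj[OF c]
  have "chart_map c x \<in> chart_map c ` (chart_dom c \<inter> chart_dom c')" using x by blast
  then obtain N g h where N: "openin (chart_codomain n c) N" "chart_map c x \<in> N"
      "N \<subseteq> chart_map c ` (chart_dom c \<inter> chart_dom c')"
    and gh: "\<forall>(x, z) \<in> N. chart_map c' (inv_into (chart_dom c) (chart_map c) (x, z)) = (g (x, z), h z)"
    using cc' unfolding foliated_coordinate_change_def by meson
  define M where "M = {y \<in> chart_dom c. chart_map c y \<in> N}"
  have "openin (subtopology X (chart_dom c)) M"
    using openin_continuous_map_preimage[OF homeomorphic_imp_continuous_map[OF product_chart_homeomorphic[OF c]] N(1)]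
      product_chart_dom[OF c] by (simp add: M_def Int_absorb1)
  then have 1: "openin X M"
    using product_chart_dom[OF c] by (simp add: openin_open_subtopology)
  have 2: "M \<subseteq> chart_dom c \<inter> chart_dom c'"
  proof
    fix y assume y: "y \<in> M"
    then have "chart_map c y \<in> chart_map c ` (chart_dom c \<inter> chart_dom c')"
      using N(3) by (auto simp: M_def)
    then show "y \<in> chart_dom c \<inter> chart_dom c'"
      using inj_on_image_mem_iff[OF inj, of y "chart_dom c \<inter> chart_dom c'"] y by (auto simp: M_def)
  qed
  have h: "transversal_coord c' y = h (transversal_coord c y)" if y: "y \<in> M" for y
  proof -
    have "chart_map c' (inv_into (chart_dom c) (chart_map c) (chart_map c y))
        = (g (chart_map c y), h (snd (chart_map c y)))"
      using gh y by (cases "chart_map c y") (auto simp: M_def)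
    moreover have "inv_into (chart_dom c) (chart_map c) (chart_map c y) = y"
      using inj y by (simp add: M_def inv_into_f_f)
    ultimately show ?thesis by (simp add: transversal_coord_def)
  qed
  have "x \<in> M" using x N by (simp add: M_def)
  then show thesis using that[OF 1 _ 2] h by metis
qed

lemma foliated_coordinate_changeI:
  assumes "\<And>x. x \<in> chart_dom c \<Longrightarrow> x \<in> chart_dom c' \<Longrightarrow>
     \<exists>N g h. openin (chart_codomain n c) N \<and> chart_map c x \<in> N \<and>
          N \<subseteq> chart_map c ` (chart_dom c \<inter> chart_dom c') \<and>
          (\<forall>(x, z) \<in> N. chart_map c' (inv_into (chart_dom c) (chart_map c) (x, z)) = (g (x, z), h z))"
  shows "foliated_coordinate_change n c c'"
  unfolding foliated_coordinate_change_def using assms by blast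

text \<open>
  Foliated charts with small plaques are needed to see that the leaf topology refines the topology of
  \<open>X\<close>; it suffices to shrink the ball and to keep the whole transversal.
\<close>

definition restrict_chart :: "(nat \<Rightarrow> real) set \<Rightarrow> ('a, 'z) foliated_chart \<Rightarrow> ('a, 'z) foliated_chart" where
  "restrict_chart B c = c\<lparr>chart_dom := {x \<in> chart_dom c. fst (chart_map c x) \<in> B}, chart_ball := B\<rparr>"

lemma restrict_chart_simps [simp]:
  "chart_dom (restrict_chart B c) = {x \<in> chart_dom c. fst (chart_map c x) \<in> B}"
  "chart_ball (restrict_chart B c) = B"
  "chart_transversal (restrict_chart B c) = chart_transversal c"
  "chart_map (restrict_chart B c) = chart_map c"
  "transversal_coord (restrict_chart B c) = transversal_coord c"
  by (auto simp: restrict_chart_def transversal_coord_def)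

context
  fixes X :: "'a topology" and n :: nat and c :: "('a, 'z) foliated_chart" and B a r
  assumes c: "product_chart X n c"
    and a: "a \<in> topspace (Euclidean_space n)" and r: "r > 0"
    and B: "B = Euclidean_open_ball n a r" "B \<subseteq> chart_ball c"
begin

lemma chart_codomain_restrict_chart:
  "chart_codomain n (restrict_chart B c) = subtopology (chart_codomain n c) (B \<times> UNIV)"
proof -
  have "(chart_ball c \<times> topspace (chart_transversal c)) \<inter> (B \<times> UNIV) = B \<times> topspace (chart_transversal c)"
    using B(2) by auto
  then show ?thesis
    by (simp add: chart_codomain_def prod_topology_subtopology subtopology_subtopology)
qed

lemma openin_chart_codomain_restrict:
  "openin (chart_codomain n c) (B \<times> topspace (chart_transversal c))"
proof -
  have "openin (Euclidean_space n) B" using openin_Euclidean_open_ball B(1) by blast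
  then have "openin (subtopology (Euclidean_space n) (chart_ball c)) B"
    using B(2) by (simp add: subset_openin_subtopology)
  then show ?thesis by (simp add: chart_codomain_def openin_prod_Times_iff)
qed

lemma product_chart_restrict_chart: "product_chart X n (restrict_chart B c)"
proof -
  let ?D = "chart_dom (restrict_chart B c)"
  have eq: "?D = {x \<in> topspace (subtopology X (chart_dom c)).
      chart_map c x \<in> B \<times> topspace (chart_transversal c)}"
    using product_chart_dom(2)[OF c] chart_map_in[OF c] by (auto simp: mem_Times_iff)
  have "openin (subtopology X (chart_dom c)) ?D"
    unfolding eq using openin_continuous_map_preimage[OF
        homeomorphic_imp_continuous_map[OF product_chart_homeomorphic[OF c]] openin_chart_codomain_restrict] .
  then have o: "openin X ?D"
    using product_chart_dom[OF c] by (simp add: openin_open_subtopology)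
  have "homeomorphic_map (subtopology (subtopology X (chart_dom c)) ?D)
      (subtopology (chart_codomain n c) (B \<times> UNIV)) (chart_map c)"
    by (rule homeomorphic_map_subtopologies_alt[OF product_chart_homeomorphic[OF c]])
       (auto simp: mem_Times_iff)
  moreover have "chart_dom c \<inter> ?D = ?D" by auto
  ultimately have "homeomorphic_map (subtopology X ?D) (chart_codomain n (restrict_chart B c)) (chart_map c)"
    by (simp add: subtopology_subtopology chart_codomain_restrict_chart)
  then show ?thesis using o c B a r unfolding product_chart_def by auto
qed

text \<open>\<open>N\<close> is cut down to \<open>B\<close>, while \<open>g\<close> and
  \<open>h\<close> stay. The two inverses, chosen on \<open>chart_dom c\<close> and on the smaller
  domain, agree by injectivity.\<close>

lemma foliated_coordinate_change_restrict_left: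
  assumes "foliated_coordinate_change n c c'"
  shows "foliated_coordinate_change n (restrict_chart B c) c'"
proof (rule foliated_coordinate_changeI)
  fix x assume x: "x \<in> chart_dom (restrict_chart B c)" "x \<in> chart_dom c'"
  then have "chart_map c x \<in> chart_map c ` (chart_dom c \<inter> chart_dom c')" by auto
  then obtain N g h where N: "openin (chart_codomain n c) N" "chart_map c x \<in> N"
      "N \<subseteq> chart_map c ` (chart_dom c \<inter> chart_dom c')"
    and gh: "\<forall>(x, z) \<in> N. chart_map c' (inv_into (chart_dom c) (chart_map c) (x, z)) = (g (x, z), h z)"
    using assms unfolding foliated_coordinate_change_def by meson
  let ?N = "N \<inter> (B \<times> UNIV)" and ?c = "restrict_chart B c"
  have "openin (chart_codomain n ?c) ?N"
    using N(1) by (simp add: chart_codomain_restrict_chart openin_subtopology_Int)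
  moreover have "chart_map ?c x \<in> ?N" using x N by (simp add: mem_Times_iff)
  moreover have sub: "?N \<subseteq> chart_map ?c ` (chart_dom ?c \<inter> chart_dom c')"
  proof
    fix p assume p: "p \<in> ?N"
    then obtain y where "y \<in> chart_dom c \<inter> chart_dom c'" "p = chart_map c y" using N(3) by blast
    then show "p \<in> chart_map ?c ` (chart_dom ?c \<inter> chart_dom c')" using p by auto
  qed
  moreover have "\<forall>(x, z) \<in> ?N. chart_map c' (inv_into (chart_dom ?c) (chart_map ?c) (x, z)) = (g (x, z), h z)"
  proof clarify
    fix u z assume uz: "(u, z) \<in> N" "u \<in> B"
    then have "(u, z) \<in> ?N" by simp
    then have "(u, z) \<in> chart_map ?c ` (chart_dom ?c \<inter> chart_dom c')" using sub by (rule subsetD[rotated])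
    then obtain y where y: "y \<in> chart_dom ?c" "chart_map c y = (u, z)"
      using image_iff by (metis IntD1 restrict_chart_simps(4))
    have "inj_on (chart_map c) (chart_dom ?c)"
      using product_chart_inj[OF c] by (auto intro: inj_on_subset)
    from inv_into_f_f[OF this y(1)] have "inv_into (chart_dom ?c) (chart_map ?c) (u, z) = y"
      using y(2) by simp
    moreover have "y \<in> chart_dom c" using y(1) by simp
    from inv_into_f_f[OF product_chart_inj[OF c] this] have "inv_into (chart_dom c) (chart_map c) (u, z) = y"
      using y(2) by simp
    ultimately show "chart_map c' (inv_into (chart_dom ?c) (chart_map ?c) (u, z)) = (g (u, z), h z)"
      using gh uz by auto
  qed
  ultimately show "\<exists>N g h. openin (chart_codomain n ?c) N \<and> chart_map ?c x \<in> N \<and>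
          N \<subseteq> chart_map ?c ` (chart_dom ?c \<inter> chart_dom c') \<and>
          (\<forall>(x, z) \<in> N. chart_map c' (inv_into (chart_dom ?c) (chart_map ?c) (x, z)) = (g (x, z), h z))"
    by - (rule exI[of _ ?N], rule exI[of _ g], rule exI[of _ h], intro conjI)
qed

lemma foliated_coordinate_change_restrict_right:
  assumes c': "product_chart X n c'" and "foliated_coordinate_change n c' c"
  shows "foliated_coordinate_change n c' (restrict_chart B c)"
proof (rule foliated_coordinate_changeI)
  let ?c = "restrict_chart B c"
  fix x assume x: "x \<in> chart_dom c'" "x \<in> chart_dom ?c"
  then have "chart_map c' x \<in> chart_map c' ` (chart_dom c' \<inter> chart_dom c)" by auto
  then obtain N g h where N: "openin (chart_codomain n c') N" "chart_map c' x \<in> N"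
      "N \<subseteq> chart_map c' ` (chart_dom c' \<inter> chart_dom c)"
    and gh: "\<forall>(x, z) \<in> N. chart_map c (inv_into (chart_dom c') (chart_map c') (x, z)) = (g (x, z), h z)"
    using assms(2) unfolding foliated_coordinate_change_def by meson
  let ?D = "chart_map c' ` (chart_dom c' \<inter> chart_dom ?c)"
  have "chart_dom c' \<inter> chart_dom ?c \<subseteq> topspace (subtopology X (chart_dom c'))"
    using product_chart_dom[OF c'] by auto
  moreover have "openin (subtopology X (chart_dom c')) (chart_dom c' \<inter> chart_dom ?c)"
    using product_chart_dom(1)[OF product_chart_restrict_chart] by (rule openin_subtopology_Int2)
  ultimately have "openin (chart_codomain n c') ?D"
    using homeomorphic_map_openness[OF product_chart_homeomorphic[OF c']] by blast
  then have "openin (chart_codomain n c') (N \<inter> ?D)" using N(1) by blast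
  moreover have "chart_map c' x \<in> N \<inter> ?D" using x N by blast
  moreover have "N \<inter> ?D \<subseteq> ?D" by simp
  moreover have "\<forall>(x, z) \<in> N \<inter> ?D. chart_map ?c (inv_into (chart_dom c') (chart_map c') (x, z)) = (g (x, z), h z)"
    using gh by auto
  ultimately show "\<exists>N g h. openin (chart_codomain n c') N \<and> chart_map c' x \<in> N \<and>
          N \<subseteq> chart_map c' ` (chart_dom c' \<inter> chart_dom ?c) \<and>
          (\<forall>(x, z) \<in> N. chart_map ?c (inv_into (chart_dom c') (chart_map c') (x, z)) = (g (x, z), h z))"
    by - (rule exI[of _ "N \<inter> ?D"], rule exI[of _ g], rule exI[of _ h], intro conjI)
qed

end

section \<open>The leaf topology\<close>

locale foliated =
  fixes X :: "'a topology" and n :: nat and \<A> :: "('a, 'z) foliated_chart set"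
  assumes atlas: "foliated_atlas X n \<A>"
begin

abbreviation "charts \<equiv> foliated_charts X n \<A>"
abbreviation "\<T> \<equiv> leaf_topology X n \<A>"

lemma charts_product: "c \<in> charts \<Longrightarrow> product_chart X n c"
  by (simp add: foliated_charts_def)

lemma charts_change:
  assumes "c \<in> charts" "c' \<in> \<A>"
  shows "foliated_coordinate_change n c c'" "foliated_coordinate_change n c' c"
  using assms by (simp_all add: foliated_charts_def)

lemma atlas_subset_charts: "\<A> \<subseteq> charts"
  using atlas by (auto simp: foliated_atlas_def foliated_charts_def)

lemma atlas_cover: "x \<in> topspace X \<Longrightarrow> \<exists>c\<in>\<A>. x \<in> chart_dom c"
  using atlas by (auto simp: foliated_atlas_def)

lemma chart_dom_subset: "c \<in> charts \<Longrightarrow> chart_dom c \<subseteq> topspace X"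
  using charts_product product_chart_dom(2) by blast

text \<open>Membership in \<open>charts\<close> only speaks of compatibility with \<A>. Two such
  charts are therefore compared through a chart \<open>c0\<close> of \<A> around
  \<open>x\<close>.\<close>

lemma transversal_coord_locally_constant:
  assumes c: "c \<in> charts" "c' \<in> charts" and x: "x \<in> chart_dom c" "x \<in> chart_dom c'"
  obtains M where "openin X M" "x \<in> M" "M \<subseteq> chart_dom c \<inter> chart_dom c'"
    "M \<inter> plaque_at c x \<subseteq> plaque_at c' x"
proof -
  obtain c0 where c0: "c0 \<in> \<A>" "x \<in> chart_dom c0"
    using atlas_cover chart_dom_subset c(1) x(1) by blast
  obtain M where M: "openin X M" "x \<in> M" "M \<subseteq> chart_dom c \<inter> chart_dom c0"
    "\<And>y. y \<in> M \<Longrightarrow> transversal_coord c y = transversal_coord c x \<Longrightarrow>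
      transversal_coord c0 y = transversal_coord c0 x"
    using coordinate_change_locally_constant[OF charts_product[OF c(1)] charts_change(1)[OF c(1) c0(1)] x(1) c0(2)]
    by metis
  obtain M' where M': "openin X M'" "x \<in> M'" "M' \<subseteq> chart_dom c0 \<inter> chart_dom c'"
    "\<And>y. y \<in> M' \<Longrightarrow> transversal_coord c0 y = transversal_coord c0 x \<Longrightarrow>
      transversal_coord c' y = transversal_coord c' x"
    using coordinate_change_locally_constant[OF charts_product[OF subsetD[OF atlas_subset_charts c0(1)]]
        charts_change(2)[OF c(2) c0(1)] c0(2) x(2)]
    by metis
  show thesis
  proof (rule that[of "M \<inter> M'"])
    show "M \<inter> M' \<inter> plaque_at c x \<subseteq> plaque_at c' x"
    proof
      fix y assume y: "y \<in> M \<inter> M' \<inter> plaque_at c x"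
      then have "transversal_coord c0 y = transversal_coord c0 x"
        using M(4) by (simp add: plaque_at_def)
      then show "y \<in> plaque_at c' x"
        using M'(3,4) y by (auto simp: plaque_at_def)
    qed
  qed (use M(1-3) M'(1-3) in auto)
qed

section \<open>Plaques in the leaf topology\<close>

lemma openin_plaque: "c \<in> charts \<Longrightarrow> P \<in> plaques c \<Longrightarrow> openin \<T> P"
  unfolding leaf_topology_def by (rule topology_generated_by_Basis) blast

lemma openin_plaque_at: "c \<in> charts \<Longrightarrow> x \<in> chart_dom c \<Longrightarrow> openin \<T> (plaque_at c x)"
  using openin_plaque plaques_eq[OF charts_product] by blast

lemma plaque_at_self: "x \<in> chart_dom c \<Longrightarrow> x \<in> plaque_at c x"
  by (simp add: plaque_at_def)

lemma plaque_at_eq: "y \<in> plaque_at c x \<Longrightarrow> plaque_at c y = plaque_at c x"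
  by (simp add: plaque_at_def)

lemma topspace_leaf_topology: "topspace \<T> = topspace X"
proof
  show "topspace \<T> \<subseteq> topspace X"
    unfolding leaf_topology_def topology_generated_by_topspace
  proof clarify
    fix x c P assume c: "c \<in> charts" and "P \<in> plaques c" "x \<in> P"
    then have "x \<in> chart_dom c" by (auto simp: plaques_def)
    then show "x \<in> topspace X" using chart_dom_subset[OF c] by blast
  qed
  show "topspace X \<subseteq> topspace \<T>"
  proof
    fix x assume "x \<in> topspace X"
    then obtain c where c: "c \<in> \<A>" "x \<in> chart_dom c" using atlas_cover by blast
    have "openin \<T> (plaque_at c x)"
      by (rule openin_plaque_at[OF subsetD[OF atlas_subset_charts c(1)] c(2)])
    from subsetD[OF openin_subset[OF this] plaque_at_self[OF c(2)]] show "x \<in> topspace \<T>" .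
  qed
qed

text \<open>
  Plaques of two foliated charts meet in relatively open sets, so on a plaque the leaf topology is not
  finer than the topology of \<open>X\<close>.
\<close>

lemma leaf_open_trace:
  assumes W: "openin \<T> W" and c: "c \<in> charts" and x: "x \<in> W" "x \<in> chart_dom c"
  shows "\<exists>M. openin X M \<and> x \<in> M \<and> M \<inter> plaque_at c x \<subseteq> W"
proof -
  have "generate_topology_on (\<Union>c \<in> charts. plaques c) W"
    using W unfolding leaf_topology_def by (simp add: openin_topology_generated_by_iff)
  then show ?thesis using x(1)
  proof induction
    case Empty
    then show ?case by simp
  next
    case (Int a b)
    then obtain M M' where "openin X M" "x \<in> M" "M \<inter> plaque_at c x \<subseteq> a"
      "openin X M'" "x \<in> M'" "M' \<inter> plaque_at c x \<subseteq> b" by auto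
    then show ?case by (intro exI[of _ "M \<inter> M'"]) auto
  next
    case (UN K)
    then obtain k where k: "k \<in> K" "x \<in> k" by blast
    with UN.IH obtain M where "openin X M" "x \<in> M" "M \<inter> plaque_at c x \<subseteq> k" by blast
    then show ?case using k(1) by blast
  next
    case (Basis s)
    then obtain c' where c': "c' \<in> charts" "s \<in> plaques c'" by blast
    then obtain y where "s = plaque_at c' y"
      using plaques_eq[OF charts_product[OF c'(1)]] by auto
    then have xc': "x \<in> chart_dom c'" "plaque_at c' x = s"
      using Basis.prems by (auto simp: plaque_at_def)
    show ?case
      by (rule transversal_coord_locally_constant[OF c c'(1) x(2) xc'(1)]) (use xc'(2) in auto)
  qed
qed

text \<open>This transports what is visible in the chart, connectedness of plaques and compactness
  of their subsets, from \<open>X\<close> to the leaf topology.\<close>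

lemma continuous_map_plaque_leaf:
  assumes c: "c \<in> charts" and x: "x \<in> chart_dom c"
  shows "continuous_map (subtopology X (plaque_at c x)) \<T> id"
proof -
  have "openin (subtopology X (plaque_at c x)) {y \<in> topspace (subtopology X (plaque_at c x)). id y \<in> W}"
    if W: "openin \<T> W" for W
  proof (subst openin_subopen, clarify)
    fix y assume y: "y \<in> topspace (subtopology X (plaque_at c x))" "id y \<in> W"
    then have yp: "y \<in> plaque_at c x" by auto
    then have "y \<in> chart_dom c" by (simp add: plaque_at_def)
    then obtain M where M: "openin X M" "y \<in> M" "M \<inter> plaque_at c y \<subseteq> W"
      using leaf_open_trace[OF W c, of y] y(2) by auto
    then have "openin (subtopology X (plaque_at c x)) (plaque_at c x \<inter> M)"
      by (simp add: openin_subtopology_Int2)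
    moreover have "plaque_at c x \<inter> M \<subseteq> {y \<in> topspace (subtopology X (plaque_at c x)). id y \<in> W}"
      using M(3) openin_subset[OF M(1)] plaque_at_eq[OF yp] by auto
    ultimately show "\<exists>T. openin (subtopology X (plaque_at c x)) T \<and> y \<in> T \<and>
        T \<subseteq> {y \<in> topspace (subtopology X (plaque_at c x)). id y \<in> W}"
      using yp M(2) by blast
  qed
  then show ?thesis
    by (auto simp: continuous_map_def topspace_leaf_topology)
qed

lemma connectedin_leaf_plaque_at:
  assumes c: "c \<in> charts" and x: "x \<in> chart_dom c"
  shows "connectedin \<T> (plaque_at c x)"
  using connectedin_continuous_map_image[OF continuous_map_plaque_leaf[OF assms], of "plaque_at c x"]
    connectedin_plaque_at[OF charts_product[OF c] x]
  by (simp add: connectedin_subtopology)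

lemma compactin_leafI:
  assumes c: "c \<in> charts" and x: "x \<in> chart_dom c" and D: "compactin X D" "D \<subseteq> plaque_at c x"
  shows "compactin \<T> D"
  using image_compactin[OF _ continuous_map_plaque_leaf[OF c x], of D] D
  by (simp add: compactin_subtopology)

lemma restrict_chart_in_charts:
  assumes c: "c \<in> charts" and a: "a \<in> topspace (Euclidean_space n)" and r: "r > 0"
    and B: "Euclidean_open_ball n a r \<subseteq> chart_ball c"
  shows "restrict_chart (Euclidean_open_ball n a r) c \<in> charts"
proof -
  note * = charts_product[OF c] a r refl B
  show ?thesis
    unfolding foliated_charts_def mem_Collect_eq
  proof (intro conjI ballI)
    fix c' assume c': "c' \<in> \<A>"
    then have pc': "product_chart X n c'" using charts_product atlas_subset_charts by blast
    show "foliated_coordinate_change n (restrict_chart (Euclidean_open_ball n a r) c) c'"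
      by (rule foliated_coordinate_change_restrict_left[OF * charts_change(1)[OF c c']])
    show "foliated_coordinate_change n c' (restrict_chart (Euclidean_open_ball n a r) c)"
      by (rule foliated_coordinate_change_restrict_right[OF * pc' charts_change(2)[OF c c']])
  qed (rule product_chart_restrict_chart[OF *])
qed

text \<open>In a chart around \<open>x\<close>, the image of \<open>V\<close> contains a box around
  the image of \<open>x\<close>. A ball inside its first factor gives a restricted chart whose
  plaque through \<open>x\<close> lies in \<open>V\<close>.\<close>

lemma openin_leaf_topology:
  assumes V: "openin X V"
  shows "openin \<T> V"
proof (subst openin_subopen, clarify)
  fix x assume x: "x \<in> V"
  then obtain c where cA: "c \<in> \<A>" and xc: "x \<in> chart_dom c"
    using atlas_cover openin_subset[OF V] by blast
  have c: "c \<in> charts" using cA atlas_subset_charts by blast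
  note pc = charts_product[OF c]
  have "chart_dom c \<inter> V \<subseteq> topspace (subtopology X (chart_dom c))"
    using chart_dom_subset[OF c] by auto
  moreover have "openin (subtopology X (chart_dom c)) (chart_dom c \<inter> V)"
    using V by (simp add: openin_subtopology_Int2)
  ultimately have "openin (chart_codomain n c) (chart_map c ` (chart_dom c \<inter> V))"
    using homeomorphic_map_openness[OF product_chart_homeomorphic[OF pc]] by blast
  moreover obtain a z where az: "chart_map c x = (a, z)" by (cases "chart_map c x")
  ultimately obtain B Z where BZ: "openin (subtopology (Euclidean_space n) (chart_ball c)) B"
      "a \<in> B" "z \<in> Z" "B \<times> Z \<subseteq> chart_map c ` (chart_dom c \<inter> V)"
  proof -
    have "(a, z) \<in> chart_map c ` (chart_dom c \<inter> V)" using x xc \<open>chart_map c x = (a, z)\<close> by (metis IntI imageI)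
    then show thesis
      using that \<open>openin (chart_codomain n c) (chart_map c ` (chart_dom c \<inter> V))\<close>
      unfolding chart_codomain_def openin_prod_topology_alt by meson
  qed
  have "openin (Euclidean_space n) (chart_ball c)"
    by (rule product_chart_ball[OF pc]) (simp add: openin_Euclidean_open_ball)
  then have B: "openin (Euclidean_space n) B" "B \<subseteq> chart_ball c"
    using BZ(1) by (auto simp: openin_open_subtopology)
  obtain r where r: "r > 0" "Euclidean_open_ball n a r \<subseteq> B"
    using Euclidean_open_ball_within[OF B(1) BZ(2)] .
  have a: "a \<in> topspace (Euclidean_space n)" using openin_subset[OF B(1)] BZ(2) by blast
  let ?c = "restrict_chart (Euclidean_open_ball n a r) c"
  have c': "?c \<in> charts"
    using restrict_chart_in_charts[OF c a r(1)] r(2) B(2) by blast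
  have xc': "x \<in> chart_dom ?c" using xc az center_in_Euclidean_open_ball[OF a r(1)] by simp
  have "plaque_at ?c x \<subseteq> V"
  proof
    fix y assume "y \<in> plaque_at ?c x"
    then have y: "y \<in> chart_dom c" "fst (chart_map c y) \<in> B" "snd (chart_map c y) = z"
      using r(2) az by (auto simp: plaque_at_def transversal_coord_def)
    then have "chart_map c y \<in> chart_map c ` (chart_dom c \<inter> V)"
      using BZ(3,4) by (metis mem_Times_iff subsetD)
    then show "y \<in> V"
      using inj_on_image_mem_iff[OF product_chart_inj[OF pc] y(1), of "chart_dom c \<inter> V"] by auto
  qed
  then show "\<exists>T. openin \<T> T \<and> x \<in> T \<and> T \<subseteq> V"
    using openin_plaque_at[OF c' xc'] plaque_at_self[OF xc'] by blast
qed

lemma continuous_map_leaf: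
  assumes "continuous_map X Y f"
  shows "continuous_map \<T> Y f"
  using assms openin_leaf_topology by (auto simp: continuous_map_def topspace_leaf_topology)

lemma saturated_plaque:
  assumes S: "saturated X n \<A> S" and c: "c \<in> charts" and x: "x \<in> S" "x \<in> chart_dom c"
  shows "plaque_at c x \<subseteq> S"
proof -
  obtain \<L> where L: "\<L> \<subseteq> leaves X n \<A>" "S = \<Union>\<L>" using S by (auto simp: saturated_def)
  then obtain C where C: "C \<in> \<L>" "x \<in> C" using x by blast
  then have "C \<in> connected_components_of \<T>" using L by (auto simp: leaves_def)
  moreover have "\<not> disjnt C (plaque_at c x)"
    using C(2) plaque_at_self[OF x(2)] by (auto simp: disjnt_iff)
  ultimately have "plaque_at c x \<subseteq> C"
    using connected_components_of_maximal[OF _ connectedin_leaf_plaque_at[OF c x(2)]] by blast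
  then show ?thesis using C L by blast
qed

lemma saturated_subset: "saturated X n \<A> S \<Longrightarrow> S \<subseteq> topspace X"
  using connected_components_of_subset[of _ \<T>] topspace_leaf_topology
  by (auto simp: saturated_def leaves_def)

text \<open>Closure under the plaques of a cover makes both \<open>S\<close> and its complement open
  in the leaf topology, so \<open>S\<close> cannot split a component.\<close>

lemma saturatedI:
  assumes \<U>: "\<U> \<subseteq> charts" "\<And>x. x \<in> topspace X \<Longrightarrow> \<exists>c\<in>\<U>. x \<in> chart_dom c"
    and S: "S \<subseteq> topspace X" "\<And>c x. c \<in> \<U> \<Longrightarrow> x \<in> S \<Longrightarrow> x \<in> chart_dom c \<Longrightarrow> plaque_at c x \<subseteq> S"
  shows "saturated X n \<A> S"
proof -
  have sub: "c \<in> charts" if "c \<in> \<U>" for c using \<U>(1) that by blast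
  have o: "openin \<T> S"
  proof (subst openin_subopen, clarify)
    fix x assume "x \<in> S"
    then obtain c where c: "c \<in> \<U>" "x \<in> chart_dom c" using \<U>(2)[of x] S(1) by blast
    show "\<exists>T. openin \<T> T \<and> x \<in> T \<and> T \<subseteq> S"
      using S(2)[OF c(1) \<open>x \<in> S\<close> c(2)] openin_plaque_at[OF sub[OF c(1)] c(2)] plaque_at_self[OF c(2)]
      by blast
  qed
  have "openin \<T> (topspace \<T> - S)"
  proof (subst openin_subopen, clarify)
    fix x assume x: "x \<in> topspace \<T>" "x \<notin> S"
    then obtain c where c: "c \<in> \<U>" "x \<in> chart_dom c" using \<U>(2)[of x] by (auto simp: topspace_leaf_topology)
    have "plaque_at c x \<inter> S = {}"
    proof (rule ccontr)
      assume "plaque_at c x \<inter> S \<noteq> {}"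
      then obtain y where y: "y \<in> plaque_at c x" "y \<in> S" by blast
      then have "y \<in> chart_dom c" by (simp add: plaque_at_def)
      from S(2)[OF c(1) y(2) this] have "plaque_at c y \<subseteq> S" .
      then show False using plaque_at_eq[OF y(1)] plaque_at_self[OF c(2)] x(2) by blast
    qed
    moreover have o: "openin \<T> (plaque_at c x)" using openin_plaque_at[OF sub[OF c(1)] c(2)] .
    ultimately show "\<exists>T. openin \<T> T \<and> x \<in> T \<and> T \<subseteq> topspace \<T> - S"
      using plaque_at_self[OF c(2)] openin_subset[OF o] by blast
  qed
  then have cl: "closedin \<T> S" using openin_subset[OF o] by (simp add: closedin_def)
  have "S = \<Union>{C \<in> leaves X n \<A>. C \<subseteq> S}"
  proof (intro equalityI subsetI)
    fix x assume x: "x \<in> S"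
    then have "x \<in> \<Union>(connected_components_of \<T>)"
      using S(1) by (auto simp: Union_connected_components_of topspace_leaf_topology)
    then obtain C where C: "C \<in> leaves X n \<A>" "x \<in> C" by (auto simp: leaves_def)
    have "connectedin \<T> C"
      using C(1) connectedin_connected_components_of by (simp add: leaves_def)
    from connectedin_clopen_cases[OF this cl o] have "C \<subseteq> S"
      using C(2) x by (auto simp: disjnt_iff)
    then show "x \<in> \<Union>{C \<in> leaves X n \<A>. C \<subseteq> S}" using C by blast
  qed auto
  then show ?thesis unfolding saturated_def by (intro exI[of _ "{C \<in> leaves X n \<A>. C \<subseteq> S}"]) auto
qed

end

section \<open>Regular atlases\<close>

lemma continuous_map_locally_eq:
  fixes f :: "'a \<Rightarrow> 'b::topological_space"
  assumes "\<And>x. x \<in> topspace T \<Longrightarrow>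
    \<exists>V h. openin T V \<and> x \<in> V \<and> continuous_map T euclidean h \<and> (\<forall>y\<in>V. f y = h y)"
  shows "continuous_map T euclidean f"
proof -
  have "openin T {x \<in> topspace T. f x \<in> W}" if W: "open W" for W
  proof (subst openin_subopen, clarify)
    fix x assume x: "x \<in> topspace T" "f x \<in> W"
    obtain V h where V: "openin T V" "x \<in> V" "continuous_map T euclidean h" "\<forall>y\<in>V. f y = h y"
      using assms[OF x(1)] by blast
    have "openin T (V \<inter> {x \<in> topspace T. h x \<in> W})"
      using openin_continuous_map_preimage[OF V(3), of W] V(1) W by (simp add: openin_Int)
    moreover have "x \<in> V \<inter> {x \<in> topspace T. h x \<in> W}" using x V by simp
    moreover have "V \<inter> {x \<in> topspace T. h x \<in> W} \<subseteq> {x \<in> topspace T. f x \<in> W}" using V(4) by auto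
    ultimately show "\<exists>V. openin T V \<and> x \<in> V \<and> V \<subseteq> {x \<in> topspace T. f x \<in> W}" by blast
  qed
  then show ?thesis by (auto simp: continuous_map_def)
qed

locale regular_foliated = foliated X n \<A>
  for X :: "'a topology" and n :: nat and \<A> :: "('a, 'z) foliated_chart set" +
  fixes \<U> :: "('a, 'z) foliated_chart set"
  assumes compact: "compact_space X" and Hausdorff: "Hausdorff_space X"
    and second_countable: "second_countable X"
    and regular: "regular_foliated_atlas X n \<A> \<U>"
begin

lemma cover_subset: "c \<in> \<U> \<Longrightarrow> c \<in> charts"
  using regular by (auto simp: regular_foliated_atlas_def)

lemma cover: "x \<in> topspace X \<Longrightarrow> \<exists>c\<in>\<U>. x \<in> chart_dom c"
  using regular by (auto simp: regular_foliated_atlas_def)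

lemma plaques_\<U>: "c \<in> \<U> \<Longrightarrow> plaques c = plaque_at c ` chart_dom c"
  using plaques_eq[OF charts_product[OF cover_subset]] .

text \<open>Local finiteness and compactness leave finitely many charts. Charts with empty domain
  are set aside because local finiteness does not count them.\<close>

lemma finite_nonempty_charts: "finite {c \<in> \<U>. chart_dom c \<noteq> {}}"
proof -
  have "\<forall>x \<in> topspace X. \<exists>V. openin X V \<and> x \<in> V \<and> finite {c \<in> \<U>. chart_dom c \<inter> V \<noteq> {}}"
    using regular by (simp add: regular_foliated_atlas_def)
  from bchoice[OF this] obtain V where V: "\<And>x. x \<in> topspace X \<Longrightarrow> openin X (V x)"
    "\<And>x. x \<in> topspace X \<Longrightarrow> x \<in> V x"
    "\<And>x. x \<in> topspace X \<Longrightarrow> finite {c \<in> \<U>. chart_dom c \<inter> V x \<noteq> {}}" by blast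
  have "\<exists>\<F>. finite \<F> \<and> \<F> \<subseteq> V ` topspace X \<and> topspace X \<subseteq> \<Union>\<F>"
  proof (rule compact[unfolded compact_space_alt, rule_format], intro conjI ballI subsetI)
    fix U assume "U \<in> V ` topspace X"
    then show "openin X U" using V(1) by blast
  next
    fix x assume "x \<in> topspace X"
    then show "x \<in> \<Union> (V ` topspace X)" using V(2) by blast
  qed
  then obtain F where F: "finite F" "F \<subseteq> topspace X" "topspace X \<subseteq> \<Union>(V ` F)"
    by (metis finite_subset_image)
  have "{c \<in> \<U>. chart_dom c \<noteq> {}} \<subseteq> (\<Union>x\<in>F. {c \<in> \<U>. chart_dom c \<inter> V x \<noteq> {}})"
  proof
    fix c assume c: "c \<in> {c \<in> \<U>. chart_dom c \<noteq> {}}"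
    then obtain y where y: "y \<in> chart_dom c" by blast
    then have "y \<in> topspace X" using chart_dom_subset[OF cover_subset, of c] c by blast
    then obtain x where "x \<in> F" "y \<in> V x" using F(3) by blast
    then show "c \<in> (\<Union>x\<in>F. {c \<in> \<U>. chart_dom c \<inter> V x \<noteq> {}})" using y c by blast
  qed
  moreover have "finite (\<Union>x\<in>F. {c \<in> \<U>. chart_dom c \<inter> V x \<noteq> {}})"
    using F(1,2) V(3) by (intro finite_UN_I) auto
  ultimately show ?thesis by (rule finite_subset)
qed

lemma chart_extension:
  assumes "c \<in> \<U>"
  obtains c' where "c' \<in> charts" "chart_restriction c c'" "X closure_of (chart_dom c) \<subseteq> chart_dom c'"
  using regular assms unfolding regular_foliated_atlas_def by meson

lemma transversal_coord_restriction:
  "chart_restriction c c' \<Longrightarrow> x \<in> chart_dom c \<Longrightarrow> transversal_coord c' x = transversal_coord c x"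
  by (simp add: chart_restriction_def transversal_coord_def)

text \<open>In the extended chart \<open>c'\<close>, a fibre of the transversal coordinate is closed
  in \<open>chart_dom c'\<close>, and this domain contains the closure of
  \<open>chart_dom c\<close>. So taking the closure in \<open>X\<close> does not leave the
  fibre.\<close>

lemma plaque_closure:
  assumes c: "c \<in> \<U>" and x: "x \<in> chart_dom c"
  obtains c' where "c' \<in> charts" "x \<in> chart_dom c'" "X closure_of (plaque_at c x) \<subseteq> plaque_at c' x"
proof -
  obtain c' where c': "c' \<in> charts" "chart_restriction c c'" "X closure_of (chart_dom c) \<subseteq> chart_dom c'"
    using chart_extension[OF c] .
  note pc' = charts_product[OF c'(1)]
  have sub: "plaque_at c x \<subseteq> chart_dom c" by (auto simp: plaque_at_def)
  have dom: "X closure_of (plaque_at c x) \<subseteq> chart_dom c'"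
    using closure_of_mono[OF sub] c'(3) by blast
  have xc': "x \<in> chart_dom c'" using c'(2) x by (auto simp: chart_restriction_def)
  let ?Y = "subtopology X (chart_dom c')"
  have "closedin (chart_transversal c') {transversal_coord c' x}"
    using product_chart_Hausdorff[OF pc'] transversal_coord_in[OF pc' xc']
    by (simp add: closedin_Hausdorff_sing_eq)
  then have cl: "closedin ?Y {y \<in> topspace ?Y. transversal_coord c' y \<in> {transversal_coord c' x}}"
    using closedin_continuous_map_preimage[OF continuous_transversal_coord[OF pc']] by blast
  have "y \<in> plaque_at c' x" if y: "y \<in> X closure_of (plaque_at c x)" for y
  proof -
    have "plaque_at c x \<subseteq> chart_dom c'" using sub c'(2) by (auto simp: chart_restriction_def)
    then have "?Y closure_of (plaque_at c x) = chart_dom c' \<inter> X closure_of (plaque_at c x)"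
      by (simp add: closure_of_subtopology Int_absorb1)
    then have "y \<in> ?Y closure_of (plaque_at c x)"
      using y dom by blast
    moreover have "plaque_at c x \<subseteq> {y \<in> topspace ?Y. transversal_coord c' y \<in> {transversal_coord c' x}}"
    proof
      fix y assume "y \<in> plaque_at c x"
      then have y: "y \<in> chart_dom c" "transversal_coord c y = transversal_coord c x"
        by (auto simp: plaque_at_def)
      then have "y \<in> chart_dom c'" using c'(2) by (auto simp: chart_restriction_def)
      then show "y \<in> {y \<in> topspace ?Y. transversal_coord c' y \<in> {transversal_coord c' x}}"
        using y x transversal_coord_restriction[OF c'(2)] chart_dom_subset[OF c'(1)] by auto
    qed
    ultimately have "y \<in> {y \<in> topspace ?Y. transversal_coord c' y \<in> {transversal_coord c' x}}"
      using closure_of_minimal[OF _ cl] by blast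
    then show ?thesis by (simp add: plaque_at_def)
  qed
  then show thesis using that[OF c'(1) xc'] by blast
qed

text \<open>The closure is taken in \<open>X\<close>, where it is compact because \<open>X\<close>
  is; it lies in a single plaque of a foliated chart, where the two topologies agree.\<close>

lemma compactin_plaque_closure:
  assumes c: "c \<in> \<U>" and x: "x \<in> chart_dom c"
  shows "compactin \<T> (X closure_of (plaque_at c x))"
proof -
  obtain c' where c': "c' \<in> charts" "x \<in> chart_dom c'" "X closure_of (plaque_at c x) \<subseteq> plaque_at c' x"
    using plaque_closure[OF assms] .
  show ?thesis
    by (rule compactin_leafI[OF c'(1,2) _ c'(3)]) (simp add: closedin_compact_space[OF compact])
qed

text \<open>The basic move along a leaf. Its powers \<open>step ^^ k\<close> describe plaque chains,
  which are easier to compose, reverse and follow plaque by plaque than connected families of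
  plaques.\<close>

definition step :: "('a \<times> 'a) set" where
  "step = {(x, y). \<exists>c\<in>\<U>. x \<in> chart_dom c \<and> y \<in> plaque_at c x}"

lemma step_iff: "(x, y) \<in> step \<longleftrightarrow> (\<exists>c\<in>\<U>. \<exists>P\<in>plaques c. x \<in> P \<and> y \<in> P)"
proof
  assume "(x, y) \<in> step"
  then obtain c where c: "c \<in> \<U>" "x \<in> chart_dom c" "y \<in> plaque_at c x"
    unfolding step_def by blast
  then show "\<exists>c\<in>\<U>. \<exists>P\<in>plaques c. x \<in> P \<and> y \<in> P"
    using plaques_\<U>[OF c(1)] plaque_at_self[OF c(2)] by blast
next
  assume "\<exists>c\<in>\<U>. \<exists>P\<in>plaques c. x \<in> P \<and> y \<in> P"
  then obtain c P where c: "c \<in> \<U>" "P \<in> plaques c" "x \<in> P" "y \<in> P" by blast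
  then obtain w where "P = plaque_at c w" using plaques_\<U>[OF c(1)] by blast
  with c show "(x, y) \<in> step" unfolding step_def by (auto simp: plaque_at_def)
qed

lemma sym_step: "sym step"
  unfolding sym_def step_def by (auto simp: plaque_at_def)

lemma step_in: "(x, y) \<in> step \<Longrightarrow> x \<in> topspace X \<and> y \<in> topspace X"
  unfolding step_def plaque_at_def using subsetD[OF chart_dom_subset[OF cover_subset]] by blast

lemma step_refl: "x \<in> topspace X \<Longrightarrow> (x, x) \<in> step"
  unfolding step_def using cover[of x] plaque_at_self[of x] by blast

text \<open>A weak form of transversal continuity: points near \<open>x\<close> can step close to
  \<open>y\<close>. It carries limit points along plaques when limit sets are shown to be
  saturated.\<close>

lemma step_transversal:
  assumes "(x, y) \<in> step" and N: "openin X N" "y \<in> N"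
  obtains M where "openin X M" "x \<in> M" "\<And>x'. x' \<in> M \<Longrightarrow> \<exists>y'\<in>N. (x', y') \<in> step"
proof -
  obtain c where c: "c \<in> \<U>" "x \<in> chart_dom c" "y \<in> plaque_at c x"
    using assms(1) unfolding step_def by blast
  obtain M where M: "openin X M" "x \<in> M" "M \<subseteq> chart_dom c" "\<And>x'. x' \<in> M \<Longrightarrow> plaque_at c x' \<inter> N \<noteq> {}"
    using plaque_at_meets_nearby[OF charts_product[OF cover_subset[OF c(1)]] c(3) N c(2)] by blast
  have "\<exists>y'\<in>N. (x', y') \<in> step" if "x' \<in> M" for x'
    using M(3) M(4)[OF that] that c(1) unfolding step_def by blast
  then show thesis using that[OF M(1,2)] by blast
qed

text \<open>Replaces connected components by the relation. Forwards, plaques are connected and so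
  stay in a leaf; backwards, \<open>saturatedI\<close> applies to the cover \<U>.\<close>

lemma saturated_iff: "saturated X n \<A> S \<longleftrightarrow> S \<subseteq> topspace X \<and> step `` S \<subseteq> S"
proof
  assume S: "saturated X n \<A> S"
  have "y \<in> S" if xy: "x \<in> S" "(x, y) \<in> step" for x y
  proof -
    obtain c where c: "c \<in> \<U>" "x \<in> chart_dom c" "y \<in> plaque_at c x"
      using xy(2) unfolding step_def by blast
    then show ?thesis using saturated_plaque[OF S cover_subset[OF c(1)] xy(1) c(2)] by blast
  qed
  then show "S \<subseteq> topspace X \<and> step `` S \<subseteq> S" using saturated_subset[OF S] by blast
next
  assume S: "S \<subseteq> topspace X \<and> step `` S \<subseteq> S"
  have "plaque_at c x \<subseteq> S" if "c \<in> \<U>" "x \<in> S" "x \<in> chart_dom c" for c x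
    using S that unfolding step_def by blast
  moreover have "\<U> \<subseteq> charts" using cover_subset by blast
  ultimately show "saturated X n \<A> S" using S by (intro saturatedI[of \<U> S] cover) auto
qed

text \<open>A tube argument in the extended chart: the part \<open>D\<close> of the closure of
  \<open>chart_dom c\<close> outside \<open>N\<close> is compact, so its transversal values form a
  closed set. The value of \<open>x\<close> avoids it because the extended plaque through
  \<open>x\<close> lies in \<open>Y\<close>, hence in \<open>N\<close>. If \<open>x\<close> is
  outside the closure, it has a neighborhood that misses the chart.\<close>

lemma chart_plaques_near_saturated:
  assumes Y: "saturated X n \<A> Y" and N: "openin X N" "Y \<subseteq> N" and x: "x \<in> Y" and c: "c \<in> \<U>"
  shows "\<exists>M. openin X M \<and> x \<in> M \<and> (\<forall>x' \<in> M \<inter> chart_dom c. plaque_at c x' \<subseteq> N)"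
proof (cases "x \<in> X closure_of (chart_dom c)")
  case False
  let ?M = "topspace X - X closure_of (chart_dom c)"
  have "openin X ?M" by (rule openin_diff) auto
  moreover have "x \<in> ?M" using False saturated_subset[OF Y] x by blast
  moreover have "?M \<inter> chart_dom c = {}"
    using closure_of_subset[OF chart_dom_subset[OF cover_subset[OF c]]] by blast
  ultimately show ?thesis by blast
next
  case True
  obtain c' where c': "c' \<in> charts" "chart_restriction c c'" "X closure_of (chart_dom c) \<subseteq> chart_dom c'"
    using chart_extension[OF c] .
  note pc' = charts_product[OF c'(1)]
  let ?X' = "subtopology X (chart_dom c')" and ?t = "transversal_coord c'"
  define D where "D = X closure_of (chart_dom c) - N"
  have xc': "x \<in> chart_dom c'" using True c'(3) by blast
  have "compactin X D" unfolding D_def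
    by (rule closedin_compact_space[OF compact]) (simp add: N(1) closedin_diff)
  then have "compactin ?X' D" using c'(3) by (auto simp: compactin_subtopology D_def)
  then have "compactin (chart_transversal c') (?t ` D)"
    using image_compactin continuous_transversal_coord[OF pc'] by blast
  then have "closedin (chart_transversal c') (?t ` D)"
    using compactin_imp_closedin product_chart_Hausdorff[OF pc'] by blast
  then have "openin (chart_transversal c') (topspace (chart_transversal c') - ?t ` D)"
    by (intro openin_diff) auto
  from openin_continuous_map_preimage[OF continuous_transversal_coord[OF pc'] this]
  have o: "openin X {y \<in> topspace ?X'. ?t y \<in> topspace (chart_transversal c') - ?t ` D}" (is "openin X ?M")
    using product_chart_dom(1)[OF pc'] by (simp add: openin_open_subtopology)
  have "?t x \<notin> ?t ` D"
  proof
    assume "?t x \<in> ?t ` D"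
    then obtain d where d: "d \<in> D" "?t d = ?t x" by force
    then have "d \<in> plaque_at c' x" using c'(3) by (auto simp: D_def plaque_at_def)
    then have "d \<in> N" using saturated_plaque[OF Y c'(1) x xc'] N(2) by blast
    then show False using d(1) by (simp add: D_def)
  qed
  then have "x \<in> ?M"
    using xc' chart_dom_subset[OF c'(1)] transversal_coord_in[OF pc' xc'] by auto
  moreover have "plaque_at c x' \<subseteq> N" if x': "x' \<in> ?M" "x' \<in> chart_dom c" for x'
  proof (rule ccontr)
    assume "\<not> plaque_at c x' \<subseteq> N"
    then obtain y where y: "y \<in> chart_dom c" "transversal_coord c y = transversal_coord c x'" "y \<notin> N"
      by (auto simp: plaque_at_def)
    then have "y \<in> D"
      using closure_of_subset[OF chart_dom_subset[OF cover_subset[OF c]]] by (auto simp: D_def)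
    moreover have "?t x' = ?t y"
      using transversal_coord_restriction[OF c'(2)] y x'(2) by simp
    ultimately show False using x'(1) by auto
  qed
  ultimately show ?thesis using o by blast
qed

lemma step_near_saturated:
  assumes Y: "saturated X n \<A> Y" and N: "openin X N" "Y \<subseteq> N"
  obtains N' where "openin X N'" "Y \<subseteq> N'" "step `` N' \<subseteq> N"
proof -
  let ?\<U> = "{c \<in> \<U>. chart_dom c \<noteq> {}}"
  have "\<exists>M. openin X M \<and> x \<in> M \<and> step `` M \<subseteq> N" if x: "x \<in> Y" for x
  proof -
    obtain M where M: "\<And>c. c \<in> \<U> \<Longrightarrow> openin X (M c)" "\<And>c. c \<in> \<U> \<Longrightarrow> x \<in> M c"
      "\<And>c. c \<in> \<U> \<Longrightarrow> \<forall>x' \<in> M c \<inter> chart_dom c. plaque_at c x' \<subseteq> N"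
    proof -
      have "\<forall>c\<in>\<U>. \<exists>M. openin X M \<and> x \<in> M \<and> (\<forall>x' \<in> M \<inter> chart_dom c. plaque_at c x' \<subseteq> N)"
        using chart_plaques_near_saturated[OF Y N x] by blast
      from bchoice[OF this] show thesis using that by blast
    qed
    have "x \<in> topspace X" using saturated_subset[OF Y] x by blast
    then have ne: "?\<U> \<noteq> {}" using cover by blast
    \<comment> \<open>Only nonempty charts can carry a step, and there are finitely many of them, so
      the intersection is open.\<close>
    let ?M = "\<Inter>c\<in>?\<U>. M c"
    have "openin X ?M" using finite_nonempty_charts ne M(1) by (intro openin_INT2) auto
    moreover have "x \<in> ?M" using M(2) by blast
    moreover have "step `` ?M \<subseteq> N"
    proof clarify
      fix x' y assume x': "x' \<in> ?M" "(x', y) \<in> step"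
      then obtain c where c: "c \<in> \<U>" "x' \<in> chart_dom c" "y \<in> plaque_at c x'"
        unfolding step_def by blast
      then have "x' \<in> M c" using x'(1) by blast
      then show "y \<in> N" using M(3)[OF c(1)] c(2,3) by blast
    qed
    ultimately show ?thesis by blast
  qed
  then have "\<forall>x\<in>Y. \<exists>M. openin X M \<and> x \<in> M \<and> step `` M \<subseteq> N" by blast
  from bchoice[OF this] obtain M where M: "\<And>x. x \<in> Y \<Longrightarrow> openin X (M x)" "\<And>x. x \<in> Y \<Longrightarrow> x \<in> M x"
    "\<And>x. x \<in> Y \<Longrightarrow> step `` M x \<subseteq> N" by blast
  show thesis
  proof (rule that[of "\<Union>x\<in>Y. M x"])
    show "openin X (\<Union>x\<in>Y. M x)" using M(1) by (intro openin_Union) auto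
    show "Y \<subseteq> (\<Union>x\<in>Y. M x)" using M(2) by blast
    show "step `` (\<Union>x\<in>Y. M x) \<subseteq> N" using M(3) by blast
  qed
qed

end

section \<open>Plaque chains\<close>

context regular_foliated
begin

lemma saturated_Union_leaves:
  assumes "saturated X n \<A> S" "L \<in> leaves X n \<A>" "x \<in> L" "x \<in> S"
  shows "L \<subseteq> S"
proof -
  obtain \<L> where \<L>: "\<L> \<subseteq> leaves X n \<A>" "S = \<Union>\<L>" using assms(1) by (auto simp: saturated_def)
  then obtain C where C: "C \<in> \<L>" "x \<in> C" using assms(4) by blast
  have "C = L"
    using pairwise_disjoint_connected_components_of[of \<T>] C \<L>(1) assms(2,3)
    unfolding leaves_def pairwise_def disjnt_iff by blast
  then show ?thesis using C \<L>(2) by blast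
qed

lemma leaf_subset: "L \<in> leaves X n \<A> \<Longrightarrow> L \<subseteq> topspace X"
  using connected_components_of_subset topspace_leaf_topology by (auto simp: leaves_def)

lemma leaf_saturated: "L \<in> leaves X n \<A> \<Longrightarrow> saturated X n \<A> L"
  unfolding saturated_def by (intro exI[of _ "{L}"]) auto

lemma leaf_step: "L \<in> leaves X n \<A> \<Longrightarrow> x \<in> L \<Longrightarrow> (x, y) \<in> step \<Longrightarrow> y \<in> L"
  using leaf_saturated saturated_iff by blast

lemma leaf_relpow: "L \<in> leaves X n \<A> \<Longrightarrow> x \<in> L \<Longrightarrow> (x, y) \<in> step ^^ k \<Longrightarrow> y \<in> L"
  by (induction k arbitrary: y) (auto intro: leaf_step)

text \<open>The points reachable from \<open>x\<close> by plaque chains form a saturated set, and a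
  saturated set that meets a leaf contains it.\<close>

lemma leaf_chain:
  assumes L: "L \<in> leaves X n \<A>" and xy: "x \<in> L" "y \<in> L"
  obtains k where "(x, y) \<in> step ^^ k"
proof -
  have "z \<in> topspace X" if "(x, z) \<in> step\<^sup>*" for z
    using that leaf_subset[OF L] xy(1) by (induction) (auto dest: step_in)
  then have "saturated X n \<A> (step\<^sup>* `` {x})"
    unfolding saturated_iff by (auto intro: rtrancl_into_rtrancl)
  from saturated_Union_leaves[OF this L xy(1)] have "(x, y) \<in> step\<^sup>*"
    using xy(2) by auto
  then show thesis using that rtrancl_imp_relpow by blast
qed

section \<open>Chains of plaques and the leaf metric\<close>

definition plaque_family :: "'a set set" where
  "plaque_family = (\<Union>c\<in>\<U>. plaques c)"

lemma plaque_familyE: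
  assumes "P \<in> plaque_family"
  obtains c x where "c \<in> \<U>" "x \<in> chart_dom c" "P = plaque_at c x"
proof -
  obtain c where c: "c \<in> \<U>" "P \<in> plaques c" using assms by (auto simp: plaque_family_def)
  then obtain x where "x \<in> chart_dom c" "P = plaque_at c x" using plaques_\<U>[OF c(1)] by blast
  then show thesis using that c(1) by blast
qed

lemma step_iff_plaque_family: "(x, y) \<in> step \<longleftrightarrow> (\<exists>P\<in>plaque_family. x \<in> P \<and> y \<in> P)"
  unfolding step_iff plaque_family_def by blast

lemma plaque_family_open: "P \<in> plaque_family \<Longrightarrow> openin \<T> P"
  by (erule plaque_familyE) (simp add: openin_plaque_at cover_subset)

lemma plaque_family_connected: "P \<in> plaque_family \<Longrightarrow> connectedin \<T> P"
  by (erule plaque_familyE) (simp add: connectedin_leaf_plaque_at cover_subset)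

lemma plaque_family_compact: "P \<in> plaque_family \<Longrightarrow> compactin \<T> (X closure_of P)"
  by (erule plaque_familyE) (simp add: compactin_plaque_closure)

lemma plaque_family_subset: "P \<in> plaque_family \<Longrightarrow> P \<subseteq> topspace X"
  using plaque_family_open openin_subset topspace_leaf_topology by metis

text \<open>\<open>plaque_dist\<close> counts distinct plaques, and a chain may repeat some, so the
  count is only bounded by \<open>k\<close>. For \<open>k = 0\<close> the family would be empty and
  contain no point.\<close>

lemma relpow_step_plaques:
  assumes "(x, y) \<in> step ^^ k" "k > 0"
  shows "\<exists>\<P> \<subseteq> plaque_family. finite \<P> \<and> card \<P> \<le> k \<and> connectedin \<T> (\<Union>\<P>) \<and> x \<in> \<Union>\<P> \<and> y \<in> \<Union>\<P>"
  using assms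
proof (induction k arbitrary: y)
  case 0
  then show ?case by simp
next
  case (Suc k)
  then obtain w where w: "(x, w) \<in> step ^^ k" "(w, y) \<in> step" by auto
  then obtain P where P: "P \<in> plaque_family" "w \<in> P" "y \<in> P"
    using step_iff_plaque_family by blast
  show ?case
  proof (cases "k = 0")
    case True
    then have "x = w" using w(1) by simp
    then show ?thesis using P True plaque_family_connected[OF P(1)] by (intro exI[of _ "{P}"]) auto
  next
    case False
    then obtain \<P> where \<P>: "\<P> \<subseteq> plaque_family" "finite \<P>" "card \<P> \<le> k" "connectedin \<T> (\<Union>\<P>)"
      "x \<in> \<Union>\<P>" "w \<in> \<Union>\<P>" using Suc.IH[OF w(1)] by blast
    have "connectedin \<T> (P \<union> \<Union>\<P>)"
      using connectedin_Un[OF plaque_family_connected[OF P(1)] \<P>(4)] P(2) \<P>(6) by blast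
    moreover have "card (insert P \<P>) \<le> Suc k"
      using \<P>(2,3) card_insert_le_m1 by (simp add: card_insert_if)
    ultimately show ?thesis using P \<P> by (intro exI[of _ "insert P \<P>"]) simp
  qed
qed

lemma plaque_dist_le:
  assumes "(x, y) \<in> step ^^ k"
  shows "plaque_dist X n \<A> \<U> x y \<le> k"
proof (cases "x = y")
  case True
  then show ?thesis by (simp add: plaque_dist_def)
next
  case False
  then have "k > 0" using assms by (cases k) auto
  from relpow_step_plaques[OF assms this] obtain \<P> where \<P>: "\<P> \<subseteq> plaque_family" "finite \<P>"
    "card \<P> \<le> k" "connectedin \<T> (\<Union>\<P>)" "x \<in> \<Union>\<P>" "y \<in> \<Union>\<P>" by blast
  have "(LEAST k. \<exists>\<P> \<subseteq> (\<Union>c \<in> \<U>. plaques c). finite \<P> \<and> card \<P> = k \<and>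
          connectedin \<T> (\<Union>\<P>) \<and> x \<in> \<Union>\<P> \<and> y \<in> \<Union>\<P>) \<le> card \<P>"
    by (rule Least_le) (use \<P> in \<open>auto simp: plaque_family_def\<close>)
  then show ?thesis using False \<P>(3) by (simp add: plaque_dist_def)
qed

text \<open>
  The crude quadratic bound suffices: only the coarse equivalence of \<^const>\<open>plaque_dist\<close> with the length
  of plaque chains is used.
\<close>

lemma connected_plaques_chain:
  assumes \<P>: "\<P> \<subseteq> plaque_family" "finite \<P>" "connectedin \<T> (\<Union>\<P>)" and xy: "x \<in> \<Union>\<P>" "y \<in> \<Union>\<P>"
  shows "\<exists>j \<le> Suc (card \<P> * card \<P>). (x, y) \<in> step ^^ j"
proof -
  \<comment> \<open>The intersection graph of the family. A path in it can be taken no longer than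
    the number of pairs in \<open>r\<close>, which gives the quadratic bound.\<close>
  define r where "r = {(P, Q) \<in> \<P> \<times> \<P>. P \<inter> Q \<noteq> {}}"
  have r: "finite r" "card r \<le> card \<P> * card \<P>"
    using \<P>(2) card_mono[of "\<P> \<times> \<P>" r] finite_subset[of r "\<P> \<times> \<P>"]
    by (auto simp: r_def card_cartesian_product)
  obtain P where P: "P \<in> \<P>" "x \<in> P" using xy by blast
  have sub: "r\<^sup>* `` {P} \<subseteq> \<P>"
  proof clarify
    fix Q assume "(P, Q) \<in> r\<^sup>*"
    then show "Q \<in> \<P>" by induction (use P(1) in \<open>auto simp: r_def\<close>)
  qed
  \<comment> \<open>The plaques reachable from \<open>P\<close> and the remaining ones give two
    disjoint open sets; connectedness leaves the second without points of the union.\<close>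
  define S S' where "S = \<Union>(r\<^sup>* `` {P})" and "S' = \<Union>(\<P> - r\<^sup>* `` {P})"
  have o: "openin \<T> S" "openin \<T> S'"
    unfolding S_def S'_def using sub \<P>(1) plaque_family_open by (auto intro!: openin_Union)
  have cov: "\<Union>\<P> \<subseteq> S \<union> S'" unfolding S_def S'_def by blast
  have "S \<inter> S' = {}"
  proof (rule ccontr)
    assume "S \<inter> S' \<noteq> {}"
    then obtain w where "w \<in> S" "w \<in> S'" by blast
    then obtain Q Q' where Q: "(P, Q) \<in> r\<^sup>*" "w \<in> Q" "Q' \<in> \<P>" "(P, Q') \<notin> r\<^sup>*" "w \<in> Q'"
      unfolding S_def S'_def by blast
    moreover have "Q \<in> \<P>" using sub Q(1) by blast
    ultimately have "(Q, Q') \<in> r" by (auto simp: r_def)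
    from rtrancl_into_rtrancl[OF Q(1) this] show False using Q(4) by contradiction
  qed
  then have disj: "S \<inter> S' \<inter> \<Union>\<P> = {}" by simp
  have xS: "x \<in> S" unfolding S_def using P by blast
  have "S' \<inter> \<Union>\<P> = {}"
  proof (rule ccontr)
    assume "S' \<inter> \<Union>\<P> \<noteq> {}"
    then have "\<exists>E1 E2. openin \<T> E1 \<and> openin \<T> E2 \<and> \<Union>\<P> \<subseteq> E1 \<union> E2 \<and> E1 \<inter> E2 \<inter> \<Union>\<P> = {} \<and>
        E1 \<inter> \<Union>\<P> \<noteq> {} \<and> E2 \<inter> \<Union>\<P> \<noteq> {}"
      using o cov disj xS xy(1) by (intro exI[of _ S] exI[of _ S'] conjI) auto
    with \<P>(3)[unfolded connectedin, THEN conjunct2] show False by (rule notE)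
  qed
  then have "y \<in> S" using xy(2) cov by blast
  then obtain Q where Q: "(P, Q) \<in> r\<^sup>*" "y \<in> Q" unfolding S_def by blast
  then obtain j where j: "j \<le> card r" "(P, Q) \<in> r ^^ j"
    using rtrancl_finite_eq_relpow[OF r(1)] by auto
  \<comment> \<open>A path with \<open>j\<close> edges visits \<open>j + 1\<close> plaques, hence
    the successor.\<close>
  have "(x, y) \<in> step ^^ Suc j" if "(P, Q) \<in> r ^^ j" "Q \<in> \<P>" "y \<in> Q" for j y Q
    using that
  proof (induction j arbitrary: Q y)
    case 0
    then show ?case using P \<P>(1) step_iff_plaque_family by auto
  next
    case (Suc j)
    then obtain Q' where Q': "(P, Q') \<in> r ^^ j" "(Q', Q) \<in> r" by auto
    then obtain w where w: "w \<in> Q'" "w \<in> Q" "Q' \<in> \<P>" by (auto simp: r_def)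
    from Suc.IH[OF Q'(1) w(3,1)] have "(x, w) \<in> step ^^ Suc j" .
    moreover have "(w, y) \<in> step" using w Suc.prems \<P>(1) step_iff_plaque_family by blast
    ultimately show ?case by (meson relpow_Suc_I)
  qed
  from this[OF j(2) _ Q(2)] sub Q(1) have "(x, y) \<in> step ^^ Suc j" by blast
  then show ?thesis using j(1) r(2) by (intro exI[of _ "Suc j"]) auto
qed

text \<open>A chain from \<open>x\<close> to \<open>y\<close> exists within the leaf, so the minimum
  in \<open>plaque_dist\<close> is attained; \<open>connected_plaques_chain\<close> turns a minimal
  family into a chain.\<close>

lemma plaque_dist_chain:
  assumes L: "L \<in> leaves X n \<A>" and xy: "x \<in> L" "y \<in> L" and k: "plaque_dist X n \<A> \<U> x y \<le> k"
  shows "\<exists>j \<le> Suc (k * k). (x, y) \<in> step ^^ j"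
proof (cases "x = y")
  case True
  then show ?thesis by (intro exI[of _ 0]) auto
next
  case False
  let ?P = "\<lambda>k. \<exists>\<P> \<subseteq> (\<Union>c \<in> \<U>. plaques c). finite \<P> \<and> card \<P> = k \<and>
          connectedin \<T> (\<Union>\<P>) \<and> x \<in> \<Union>\<P> \<and> y \<in> \<Union>\<P>"
  obtain m where m: "(x, y) \<in> step ^^ m" using leaf_chain[OF L xy] .
  then have "m > 0" using False by (cases m) auto
  from relpow_step_plaques[OF m this] have "\<exists>k. ?P k" unfolding plaque_family_def by blast
  then have "?P (LEAST k. ?P k)" by (rule LeastI_ex)
  then have "?P (plaque_dist X n \<A> \<U> x y)" using False by (simp add: plaque_dist_def)
  then obtain \<P> where \<P>: "\<P> \<subseteq> plaque_family" "finite \<P>" "card \<P> = plaque_dist X n \<A> \<U> x y"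
    "connectedin \<T> (\<Union>\<P>)" "x \<in> \<Union>\<P>" "y \<in> \<Union>\<P>" unfolding plaque_family_def by blast
  from connected_plaques_chain[OF \<P>(1,2,4-6)] obtain j
    where "j \<le> Suc (card \<P> * card \<P>)" "(x, y) \<in> step ^^ j" by blast
  moreover have "card \<P> * card \<P> \<le> k * k" using k \<P>(3) by (simp add: mult_le_mono)
  ultimately show ?thesis by (meson Suc_le_mono le_trans)
qed

text \<open>By regularity, applied to the closures, \<open>P\<close> meets at most one plaque of
  each chart, and only finitely many charts are nonempty.\<close>

lemma finite_plaque_neighbours:
  assumes "P \<in> plaque_family"
  shows "finite {Q \<in> plaque_family. P \<inter> Q \<noteq> {}}"
proof -
  have one: "Q = Q'" if c: "c \<in> \<U>" and Q: "Q \<in> plaques c" "Q' \<in> plaques c" "P \<inter> Q \<noteq> {}" "P \<inter> Q' \<noteq> {}" for c Q Q'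
  proof -
    obtain c0 where c0: "c0 \<in> \<U>" "P \<in> plaques c0" using assms by (auto simp: plaque_family_def)
    have cl: "A \<subseteq> X closure_of A" if "A \<in> plaque_family" for A
      using closure_of_subset[OF plaque_family_subset[OF that]] .
    have "Q \<in> plaque_family" "Q' \<in> plaque_family" using c Q by (auto simp: plaque_family_def)
    from cl[OF this(1)] cl[OF this(2)] cl[OF assms]
    have "X closure_of P \<inter> X closure_of Q \<noteq> {}" "X closure_of P \<inter> X closure_of Q' \<noteq> {}"
      using Q(3,4) by blast+
    then show ?thesis using regular c0 c Q(1,2) unfolding regular_foliated_atlas_def by meson
  qed
  let ?\<U> = "{c \<in> \<U>. chart_dom c \<noteq> {}}"
  have "{Q \<in> plaque_family. P \<inter> Q \<noteq> {}} \<subseteq> (\<Union>c\<in>?\<U>. {Q \<in> plaques c. P \<inter> Q \<noteq> {}})"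
  proof
    fix Q assume "Q \<in> {Q \<in> plaque_family. P \<inter> Q \<noteq> {}}"
    then obtain c where c: "c \<in> \<U>" "Q \<in> plaques c" "P \<inter> Q \<noteq> {}" by (auto simp: plaque_family_def)
    then have "chart_dom c \<noteq> {}" using plaques_\<U>[OF c(1)] by blast
    then show "Q \<in> (\<Union>c\<in>?\<U>. {Q \<in> plaques c. P \<inter> Q \<noteq> {}})" using c by blast
  qed
  moreover have "finite {Q \<in> plaques c. P \<inter> Q \<noteq> {}}" if c: "c \<in> ?\<U>" for c
  proof (cases "\<exists>Q0. Q0 \<in> plaques c \<and> P \<inter> Q0 \<noteq> {}")
    case True
    then obtain Q0 where "Q0 \<in> plaques c" "P \<inter> Q0 \<noteq> {}" by blast
    then have "{Q \<in> plaques c. P \<inter> Q \<noteq> {}} \<subseteq> {Q0}" using one[of c _ Q0] c by blast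
    then show ?thesis by (rule finite_subset) simp
  next
    case False
    then have "{Q \<in> plaques c. P \<inter> Q \<noteq> {}} = {}" by blast
    then show ?thesis by (metis finite.emptyI)
  qed
  ultimately show ?thesis using finite_nonempty_charts by (meson finite_UN_I finite_subset)
qed

lemma relpow_step_finite_plaques:
  assumes "x \<in> topspace X"
  shows "\<exists>\<P> \<subseteq> plaque_family. finite \<P> \<and> (step ^^ k) `` {x} \<subseteq> \<Union>\<P>"
proof (induction k)
  case 0
  obtain P where "P \<in> plaque_family" "x \<in> P"
    using step_refl[OF assms] step_iff_plaque_family by blast
  then show ?case by (intro exI[of _ "{P}"]) auto
next
  case (Suc k)
  then obtain \<P> where \<P>: "\<P> \<subseteq> plaque_family" "finite \<P>" "(step ^^ k) `` {x} \<subseteq> \<Union>\<P>" by blast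
  let ?Q = "\<Union>P\<in>\<P>. {Q \<in> plaque_family. P \<inter> Q \<noteq> {}}"
  have "finite ?Q" using \<P>(1,2) finite_plaque_neighbours by (intro finite_UN_I) auto
  moreover have "(step ^^ Suc k) `` {x} \<subseteq> \<Union>?Q"
  proof
    fix y assume "y \<in> (step ^^ Suc k) `` {x}"
    then obtain w where w: "(x, w) \<in> step ^^ k" "(w, y) \<in> step" by auto
    then obtain P where P: "P \<in> \<P>" "w \<in> P" using \<P>(3) by blast
    obtain Q where "Q \<in> plaque_family" "w \<in> Q" "y \<in> Q" using w(2) step_iff_plaque_family by blast
    then show "y \<in> \<Union>?Q" using P by blast
  qed
  moreover have "?Q \<subseteq> plaque_family" by blast
  ultimately show ?case by blast
qed

text \<open>Finitely many plaques cover the points within \<open>k\<close> steps, and their closures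
  are compact in the leaf topology. Read contrapositively, points of the leaf outside a suitable
  compact set are not reached from \<open>x\<close> in \<open>k\<close> steps; infinity in the leaf
  is used in this form.\<close>

lemma relpow_step_relatively_compact:
  assumes L: "L \<in> leaves X n \<A>" and x: "x \<in> L"
  obtains C where "compactin (subtopology \<T> L) C" "(step ^^ k) `` {x} \<subseteq> C"
proof -
  have "x \<in> topspace X" using leaf_subset[OF L] x by blast
  from relpow_step_finite_plaques[OF this, of k] obtain \<P>
    where \<P>: "\<P> \<subseteq> plaque_family" "finite \<P>" "(step ^^ k) `` {x} \<subseteq> \<Union>\<P>" by blast
  let ?C = "\<Union>P\<in>\<P>. X closure_of P"
  have comp: "compactin \<T> ?C"
    using \<P>(1,2) plaque_family_compact by (intro compactin_Union) auto
  \<comment> \<open>Shows that \<open>L\<close> is closed in the leaf topology, so that cutting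
    \<open>?C\<close> down to \<open>L\<close> keeps it compact.\<close>
  have "openin \<T> (topspace \<T> - L)"
  proof (subst openin_subopen, intro ballI)
    fix y assume y: "y \<in> topspace \<T> - L"
    then obtain P where P: "P \<in> plaque_family" "y \<in> P"
      using step_refl[of y] by (auto simp: step_iff_plaque_family topspace_leaf_topology)
    have "P \<inter> L = {}"
    proof (rule ccontr)
      assume "P \<inter> L \<noteq> {}"
      then obtain z where z: "z \<in> P" "z \<in> L" by blast
      then have "(z, y) \<in> step" using P by (auto simp: step_iff_plaque_family)
      then show False using leaf_step[OF L z(2)] y by blast
    qed
    moreover have "P \<subseteq> topspace \<T>" using openin_subset[OF plaque_family_open[OF P(1)]] .
    ultimately show "\<exists>T. openin \<T> T \<and> y \<in> T \<and> T \<subseteq> topspace \<T> - L"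
      using plaque_family_open[OF P(1)] P(2) by blast
  qed
  then have "closedin \<T> L" using leaf_subset[OF L] topspace_leaf_topology by (simp add: closedin_def)
  then have "compactin \<T> (?C \<inter> L)" using comp by (rule compact_Int_closedin[rotated])
  then have "compactin (subtopology \<T> L) (?C \<inter> L)" by (simp add: compactin_subtopology)
  moreover have "(step ^^ k) `` {x} \<subseteq> ?C \<inter> L"
  proof
    fix y assume y: "y \<in> (step ^^ k) `` {x}"
    then obtain P where P: "P \<in> \<P>" "y \<in> P" using \<P>(3) by blast
    then have "y \<in> X closure_of P"
      using closure_of_subset[OF plaque_family_subset] \<P>(1) by blast
    then show "y \<in> ?C \<inter> L" using P(1) y leaf_relpow[OF L x] by blast
  qed
  ultimately show thesis using that by blast
qed

text \<open>
  A partition of unity before normalization. The points \<open>r x\<close> are representatives of the plaques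
  of one chart, so \<open>g (r x)\<close> is locally constant along the leaves.
\<close>

lemma plaque_partition_at:
  assumes p: "p \<in> topspace X"
  obtains u r where "continuous_map X euclideanreal u" "\<And>x. u x \<ge> 0" "u p > 0"
    "\<And>x. x \<in> topspace X \<Longrightarrow> u x > 0 \<Longrightarrow> (x, r x) \<in> step"
    "\<And>g :: 'a \<Rightarrow> real. continuous_map \<T> euclideanreal (\<lambda>x. u x * g (r x))"
proof -
  obtain c where c: "c \<in> \<U>" "p \<in> chart_dom c" using cover[OF p] by blast
  have "completely_regular_space X"
    using normal_imp_completely_regular_space compact_Hausdorff_or_regular_imp_normal_space
      compact Hausdorff by blast
  moreover have "closedin X (topspace X - chart_dom c)"
    using product_chart_dom(1)[OF charts_product[OF cover_subset[OF c(1)]]] by (intro closedin_diff) auto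
  ultimately obtain f :: "'a \<Rightarrow> real" where f: "continuous_map X (top_of_set {0..1}) f" "f p = 0"
    "f ` (topspace X - chart_dom c) \<subseteq> {1}"
    using p c(2) unfolding completely_regular_space_def by (metis DiffE DiffI)
  have fc: "continuous_map X euclideanreal f" using f(1) by (simp add: continuous_map_in_subtopology)
  \<comment> \<open>The threshold 1/2 makes \<open>u\<close> vanish on the open set where
    \<open>f > 1/2\<close>, which contains all points outside the chart. This gives continuity
    there, although \<open>r\<close> carries no information outside the chart.\<close>
  define u where "u x = max 0 (1/2 - f x)" for x
  define r where "r x = (SOME y. y \<in> plaque_at c x)" for x
  have r: "r x \<in> plaque_at c x" if "x \<in> chart_dom c" for x
    unfolding r_def using plaque_at_self[OF that] by (rule someI)
  have uc: "continuous_map X euclideanreal u"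
    unfolding u_def by (intro continuous_intros continuous_map_real_max fc)
  have supp: "x \<in> chart_dom c" if "x \<in> topspace X" "f x \<noteq> 1" for x
    using f(3) that by (auto simp: image_subset_iff)
  have "continuous_map \<T> euclideanreal (\<lambda>x. u x * g (r x))" for g :: "'a \<Rightarrow> real"
  proof (rule continuous_map_locally_eq)
    fix x assume "x \<in> topspace \<T>"
    then have x: "x \<in> topspace X" by (simp add: topspace_leaf_topology)
    show "\<exists>V h. openin \<T> V \<and> x \<in> V \<and> continuous_map \<T> euclideanreal h \<and> (\<forall>y\<in>V. u y * g (r y) = h y)"
    proof (cases "x \<in> chart_dom c")
      case True
      have "u y * g (r y) = u y * g (r x)" if "y \<in> plaque_at c x" for y
        using plaque_at_eq[OF that] by (simp add: r_def)
      moreover have "continuous_map \<T> euclideanreal (\<lambda>y. u y * g (r x))"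
        by (rule continuous_map_real_mult[OF continuous_map_leaf[OF uc]]) simp
      ultimately show ?thesis
        using openin_plaque_at[OF cover_subset[OF c(1)] True] plaque_at_self[OF True]
        by (intro exI[of _ "plaque_at c x"] exI[of _ "\<lambda>y. u y * g (r x)"] conjI ballI)
    next
      case False
      let ?V = "{y \<in> topspace X. f y \<in> {1/2<..}}"
      have "openin \<T> ?V"
        using openin_leaf_topology[OF openin_continuous_map_preimage[OF fc, of "{1/2<..}"]] by simp
      moreover have "x \<in> ?V" using False x supp[of x] by fastforce
      moreover have "\<forall>y\<in>?V. u y * g (r y) = 0" by (auto simp: u_def)
      ultimately show ?thesis by (intro exI[of _ ?V] exI[of _ "\<lambda>y. 0"]) simp
    qed
  qed
  moreover have "(x, r x) \<in> step" if "x \<in> topspace X" "u x > 0" for x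
  proof -
    have "x \<in> chart_dom c" using supp that by (auto simp: u_def max_def split: if_splits)
    then show ?thesis using r c(1) unfolding step_def by blast
  qed
  ultimately show thesis using that[of u r] uc f(2) by (simp add: u_def)
qed

text \<open>Compactness reduces to finitely many pairs. The continuity clause holds for every
  \<open>g\<close>, so averages formed with these weights are continuous in the leaf topology even
  if \<open>g\<close> is not. \<open>weighted_mean\<close> divides by the sum of the
  weights.\<close>

lemma plaque_partition:
  obtains J :: "(('a \<Rightarrow> real) \<times> ('a \<Rightarrow> 'a)) set" where "finite J"
    "\<And>u r x. (u, r) \<in> J \<Longrightarrow> u x \<ge> 0"
    "\<And>u r x. (u, r) \<in> J \<Longrightarrow> x \<in> topspace X \<Longrightarrow> u x > 0 \<Longrightarrow> (x, r x) \<in> step"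
    "\<And>u r g. (u, r) \<in> J \<Longrightarrow> continuous_map \<T> euclideanreal (\<lambda>x. u x * g (r x))"
    "\<And>x. x \<in> topspace X \<Longrightarrow> (\<Sum>(u, r)\<in>J. u x) > 0"
proof -
  define good where "good j \<longleftrightarrow> continuous_map X euclideanreal (fst j) \<and> (\<forall>x. fst j x \<ge> 0) \<and>
    (\<forall>x\<in>topspace X. fst j x > 0 \<longrightarrow> (x, snd j x) \<in> step) \<and>
    (\<forall>g. continuous_map \<T> euclideanreal (\<lambda>x. fst j x * g (snd j x)))" for j :: "('a \<Rightarrow> real) \<times> ('a \<Rightarrow> 'a)"
  have "\<forall>p\<in>topspace X. \<exists>j. good j \<and> fst j p > 0"
  proof
    fix p assume p: "p \<in> topspace X"
    show "\<exists>j. good j \<and> fst j p > 0"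
    proof (rule plaque_partition_at[OF p])
      fix u and r :: "'a \<Rightarrow> 'a"
      assume "continuous_map X euclideanreal u" "\<And>x. u x \<ge> 0" "u p > 0"
        "\<And>x. x \<in> topspace X \<Longrightarrow> u x > 0 \<Longrightarrow> (x, r x) \<in> step"
        "\<And>g :: 'a \<Rightarrow> real. continuous_map \<T> euclideanreal (\<lambda>x. u x * g (r x))"
      then have "good (u, r) \<and> fst (u, r) p > 0" by (simp add: good_def)
      then show ?thesis by blast
    qed
  qed
  from bchoice[OF this] obtain j where j: "\<And>p. p \<in> topspace X \<Longrightarrow> good (j p)"
    "\<And>p. p \<in> topspace X \<Longrightarrow> fst (j p) p > 0" by blast
  define V where "V p = {x \<in> topspace X. fst (j p) x \<in> {0<..}}" for p
  have "openin X (V p)" if "p \<in> topspace X" for p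
    unfolding V_def using j(1)[OF that] by (intro openin_continuous_map_preimage[of X euclideanreal]) (auto simp: good_def)
  moreover have "p \<in> V p" if "p \<in> topspace X" for p using j(2)[OF that] that by (simp add: V_def)
  ultimately have "\<exists>\<F>. finite \<F> \<and> \<F> \<subseteq> V ` topspace X \<and> topspace X \<subseteq> \<Union>\<F>"
    by (intro compact[unfolded compact_space_alt, rule_format] conjI) auto
  then obtain F where F: "finite F" "F \<subseteq> topspace X" "topspace X \<subseteq> \<Union>(V ` F)"
    by (metis finite_subset_image)
  let ?J = "j ` F"
  have good: "good k" if "k \<in> ?J" for k using that j(1) F(2) by blast
  show thesis
  proof (rule that[of ?J])
    show "finite ?J" using F(1) by simp
    show "u x \<ge> 0" if "(u, r) \<in> ?J" for u r x
      using good[OF that] by (simp add: good_def)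
    show "(x, r x) \<in> step" if "(u, r) \<in> ?J" "x \<in> topspace X" "u x > 0" for u r x
      using good[OF that(1)] that by (simp add: good_def)
    show "continuous_map \<T> euclideanreal (\<lambda>x. u x * g (r x))" if "(u, r) \<in> ?J" for u r g
      using good[OF that] by (simp add: good_def)
    show "(\<Sum>(u, r)\<in>?J. u x) > 0" if x: "x \<in> topspace X" for x
    proof -
      obtain p where p: "p \<in> F" "x \<in> V p" using F(3) x by blast
      have "(\<Sum>k\<in>?J. fst k x) > 0"
      proof (rule sum_pos2)
        show "j p \<in> ?J" "0 < fst (j p) x" using p by (auto simp: V_def)
        show "0 \<le> fst k x" if "k \<in> ?J" for k using good[OF that] by (simp add: good_def)
      qed (use F(1) in simp)
      then show ?thesis by (simp add: case_prod_unfold)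
    qed
  qed
qed

end

section \<open>Limit sets of corona points\<close>

text \<open>Directedness places a member of \<C> inside every finite intersection. Used both for
  chains of saturated sets and for the closures that define a limit set.\<close>

lemma compact_space_directed_Inter:
  assumes X: "compact_space X" and ne: "\<C> \<noteq> {}" "\<And>C. C \<in> \<C> \<Longrightarrow> closedin X C \<and> C \<noteq> {}"
    and dir: "\<And>C D. C \<in> \<C> \<Longrightarrow> D \<in> \<C> \<Longrightarrow> \<exists>E\<in>\<C>. E \<subseteq> C \<inter> D"
  shows "\<Inter>\<C> \<noteq> {}"
proof -
  have "\<exists>E\<in>\<C>. E \<subseteq> \<Inter>\<F>" if "finite \<F>" "\<F> \<subseteq> \<C>" for \<F>
    using that
  proof (induction \<F>)
    case empty
    then show ?case using ne(1) by auto
  next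
    case (insert C \<F>)
    then obtain D where D: "D \<in> \<C>" "D \<subseteq> \<Inter>\<F>" by auto
    from dir[OF _ D(1), of C] obtain E where "E \<in> \<C>" "E \<subseteq> C \<inter> D" using insert.prems by auto
    then show ?case using D(2) by (intro bexI[of _ E]) auto
  qed
  note sub = this
  show ?thesis
  proof (rule X[unfolded compact_space_fip, rule_format], intro conjI ballI allI impI)
    show "closedin X C" if "C \<in> \<C>" for C using ne(2)[OF that] by blast
    fix \<F> assume \<F>: "finite \<F> \<and> \<F> \<subseteq> \<C>"
    from sub[OF conjunct1[OF \<F>] conjunct2[OF \<F>]] obtain E where E: "E \<in> \<C>" "E \<subseteq> \<Inter>\<F>" ..
    from ne(2)[OF E(1)] have "E \<noteq> {}" ..
    then show "\<Inter>\<F> \<noteq> {}" using E(2) by (metis subset_empty)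
  qed
qed

text \<open>Intersect more and more complements of closures of basic open sets, taking those whose
  closures miss \<open>Y\<close>. Regularity provides such a basic set around any point outside
  \<open>Y\<close>; once the complement of its closure has been used, the point is outside the
  closure of \<open>N k\<close>.\<close>

lemma closed_neighbourhood_sequence:
  assumes X: "regular_space X" "second_countable X" and Y: "closedin X Y"
  shows "\<exists>N. (\<forall>k::nat. openin X (N k) \<and> Y \<subseteq> N k) \<and> decseq N \<and> (\<Inter>k. X closure_of N k) \<subseteq> Y"
proof -
  from X(2)[unfolded second_countable_def] obtain \<B> where "countable \<B> \<and> (\<forall>V \<in> \<B>. openin X V) \<and>
      (\<forall>U x. openin X U \<and> x \<in> U \<longrightarrow> (\<exists>V \<in> \<B>. x \<in> V \<and> V \<subseteq> U))" ..
  then have \<B>: "countable \<B>" "\<And>V. V \<in> \<B> \<Longrightarrow> openin X V"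
    "\<And>U x. openin X U \<Longrightarrow> x \<in> U \<Longrightarrow> \<exists>V\<in>\<B>. x \<in> V \<and> V \<subseteq> U"
    by simp_all
  \<comment> \<open>\<open>topspace X\<close> is inserted so that the countable family is nonempty
    and can be enumerated by \<open>from_nat_into\<close>.\<close>
  define \<D> where "\<D> = insert (topspace X) ((\<lambda>B. topspace X - X closure_of B) ` {B \<in> \<B>. Y \<inter> X closure_of B = {}})"
  have cD: "countable \<D>" "\<D> \<noteq> {}" unfolding \<D>_def using \<B>(1) by auto
  have D: "openin X D" "Y \<subseteq> D" if "D \<in> \<D>" for D
    using that closedin_subset[OF Y] by (auto simp: \<D>_def intro: openin_diff)
  define N where "N k = (\<Inter>j\<in>{..k}. from_nat_into \<D> j)" for k
  have N: "openin X (N k)" "Y \<subseteq> N k" for k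
  proof -
    show "openin X (N k)" unfolding N_def
      by (rule openin_INT2) (use D(1) from_nat_into[OF cD(2)] in auto)
    show "Y \<subseteq> N k" unfolding N_def using D(2)[OF from_nat_into[OF cD(2)]] by blast
  qed
  have "x \<in> Y" if x: "x \<in> (\<Inter>k. X closure_of N k)" for x
  proof (rule ccontr)
    assume "x \<notin> Y"
    moreover have "x \<in> X closure_of N 0" using x by blast
    then have "x \<in> topspace X" by (rule subsetD[OF closure_of_subset_topspace])
    ultimately obtain U where U: "openin X U" "x \<in> U" "disjnt Y (X closure_of U)"
      using X(1)[unfolded regular_space, rule_format, of Y x] Y by blast
    obtain B where B: "B \<in> \<B>" "x \<in> B" "B \<subseteq> U" using \<B>(3)[OF U(1,2)] by blast
    have "Y \<inter> X closure_of B = {}"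
      using U(3) closure_of_mono[OF B(3)] by (auto simp: disjnt_iff)
    then have "topspace X - X closure_of B \<in> \<D>" using B(1) by (auto simp: \<D>_def)
    then obtain j where j: "from_nat_into \<D> j = topspace X - X closure_of B"
      using from_nat_into_surj[OF cD(1)] by blast
    have "N j \<subseteq> from_nat_into \<D> j" unfolding N_def by blast
    then have "N j \<inter> B = {}"
      using closure_of_subset[OF openin_subset[OF \<B>(2)[OF B(1)]]] unfolding j by blast
    moreover have "x \<in> X closure_of N j" using x by blast
    ultimately show False using \<B>(2)[OF B(1)] B(2) unfolding in_closure_of by blast
  qed
  then have "(\<Inter>k. X closure_of N k) \<subseteq> Y" by blast
  moreover have "decseq N" unfolding N_def decseq_def by (intro allI impI INT_anti_mono) auto
  ultimately show ?thesis using N by blast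
qed

context regular_foliated
begin

lemma X_regular: "regular_space X"
  using compact_Hausdorff_imp_regular_space compact Hausdorff .

section \<open>Existence of minimal sets\<close>

lemma saturated_Inter:
  assumes "\<C> \<noteq> {}" "\<And>C. C \<in> \<C> \<Longrightarrow> saturated X n \<A> C"
  shows "saturated X n \<A> (\<Inter>\<C>)"
proof -
  have C: "C \<subseteq> topspace X" "step `` C \<subseteq> C" if "C \<in> \<C>" for C
    using assms(2)[OF that] by (simp_all add: saturated_iff)
  obtain C0 where C0: "C0 \<in> \<C>" using assms(1) by blast
  have "\<Inter>\<C> \<subseteq> topspace X" by (rule subset_trans[OF Inter_lower[OF C0] C(1)[OF C0]])
  moreover have "step `` \<Inter>\<C> \<subseteq> \<Inter>\<C>"
  proof (rule Inter_greatest)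
    fix C assume "C \<in> \<C>"
    then show "step `` \<Inter>\<C> \<subseteq> C" using C(2)[of C] by blast
  qed
  ultimately show ?thesis by (simp add: saturated_iff)
qed

text \<open>Zorn's lemma; compactness keeps the intersection of a chain nonempty.\<close>

lemma minimal_set_exists:
  assumes S: "S \<noteq> {}" "saturated X n \<A> S" "closedin X S"
  obtains Y where "Y \<in> minimal_sets X n \<A>" "Y \<subseteq> S"
proof -
  define good where "good Y \<longleftrightarrow> Y \<noteq> {} \<and> saturated X n \<A> Y \<and> closedin X Y \<and> Y \<subseteq> S" for Y
  have good_sub: "Y \<subseteq> topspace X" if "good Y" for Y
    using that closedin_subset by (auto simp: good_def)
  \<comment> \<open>Passing to complements turns minimal sets into maximal ones, the form that
    \<open>subset_Zorn_nonempty\<close> delivers.\<close>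
  let ?A = "(\<lambda>Y. topspace X - Y) ` Collect good"
  have "\<exists>M\<in>?A. \<forall>Z\<in>?A. M \<subseteq> Z \<longrightarrow> Z = M"
  proof (rule subset_Zorn_nonempty)
    have "good S" using S by (simp add: good_def)
    then show "?A \<noteq> {}" by blast
    fix \<C> assume \<C>: "\<C> \<noteq> {}" "subset.chain ?A \<C>"
    let ?D = "(\<lambda>Z. topspace X - Z) ` \<C>"
    have good: "good D" if D: "D \<in> ?D" for D
    proof -
      obtain Z where Z: "Z \<in> \<C>" "D = topspace X - Z" using D by blast
      moreover have "\<C> \<subseteq> ?A" using \<C>(2) by (simp add: subset_chain_def)
      ultimately obtain Y where "good Y" "Z = topspace X - Y" by blast
      then show ?thesis using good_sub[of Y] Z(2) by (simp add: double_diff)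
    qed
    have ne: "\<Inter>?D \<noteq> {}"
    proof (rule compact_space_directed_Inter[OF compact])
      fix C D assume "C \<in> ?D" "D \<in> ?D"
      then have "C \<subseteq> D \<or> D \<subseteq> C" using \<C>(2) unfolding subset_chain_def by blast
      then show "\<exists>E\<in>?D. E \<subseteq> C \<inter> D" using \<open>C \<in> ?D\<close> \<open>D \<in> ?D\<close> by blast
    qed (use \<C>(1) good in \<open>auto simp: good_def\<close>)
    obtain D0 where D0: "D0 \<in> ?D" using \<C>(1) by blast
    have "?D \<noteq> {}" using \<C>(1) by blast
    moreover have "saturated X n \<A> D" "closedin X D" if "D \<in> ?D" for D
      using good[OF that] by (simp_all add: good_def)
    ultimately have "saturated X n \<A> (\<Inter>?D)" "closedin X (\<Inter>?D)"
      using saturated_Inter[of ?D] closedin_Inter[of ?D X] by blast+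
    moreover have "D0 \<subseteq> S" using good[OF D0] by (simp add: good_def)
    then have "\<Inter>?D \<subseteq> S" using Inter_lower[OF D0] by (rule subset_trans[rotated])
    ultimately have "good (\<Inter>?D)" using ne by (simp add: good_def)
    moreover have "\<Union>\<C> = topspace X - \<Inter>?D"
    proof -
      have "Z \<subseteq> topspace X" if "Z \<in> \<C>" for Z
        using subsetD[of \<C> ?A Z] that \<C>(2) by (auto simp: subset_chain_def)
      then show ?thesis by blast
    qed
    ultimately show "\<Union>\<C> \<in> ?A" by blast
  qed
  then obtain Y where Y: "good Y" "\<And>Z. good Z \<Longrightarrow> topspace X - Y \<subseteq> topspace X - Z \<Longrightarrow> topspace X - Z = topspace X - Y"
    by auto
  have "Z = Y" if Z: "Z \<noteq> {}" "saturated X n \<A> Z" "closedin X Z" "Z \<subseteq> Y" for Z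
  proof -
    have "good Z" using Z Y(1) by (auto simp: good_def)
    moreover have "topspace X - Y \<subseteq> topspace X - Z" using Z(4) by blast
    ultimately have "topspace X - Z = topspace X - Y" by (rule Y(2))
    then show ?thesis using good_sub[OF Y(1)] good_sub[OF \<open>good Z\<close>] by (metis double_diff order_refl)
  qed
  then have "Y \<in> minimal_sets X n \<A>"
    using Y(1) by (auto simp: minimal_sets_def good_def)
  then show thesis using that Y(1) by (auto simp: good_def)
qed

text \<open>Every point of \<open>X\<close> steps to itself, so chains can be padded:
  \<open>step ^^ k\<close> describes distance at most \<open>k\<close>.\<close>

lemma relpow_step_mono:
  assumes "(x, y) \<in> step ^^ j" "j \<le> k" "x \<in> topspace X"
  shows "(x, y) \<in> step ^^ k"
  using assms(2)
proof (induction rule: dec_induct)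
  case base
  then show ?case by (rule assms(1))
next
  case (step m)
  have "y \<in> topspace X" using assms(1,3) by (cases j) (auto dest: step_in)
  then show ?case using step.IH step_refl by auto
qed

lemma relpow_step_sym: "(x, y) \<in> step ^^ k \<Longrightarrow> (y, x) \<in> step ^^ k"
proof (induction k arbitrary: y)
  case (Suc k)
  then obtain w where "(x, w) \<in> step ^^ k" "(w, y) \<in> step" by auto
  then show ?case using Suc.IH symD[OF sym_step] by (meson relpow_Suc_I2)
qed simp

lemma relpow_step_trans: "(x, y) \<in> step ^^ j \<Longrightarrow> (y, z) \<in> step ^^ k \<Longrightarrow> (x, z) \<in> step ^^ (j + k)"
  by (auto simp: relpow_add)

lemma relpow_step_near_saturated:
  assumes Y: "saturated X n \<A> Y" and N: "openin X N" "Y \<subseteq> N"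
  obtains N' where "openin X N'" "Y \<subseteq> N'" "(step ^^ k) `` N' \<subseteq> N"
proof -
  have "\<exists>N'. openin X N' \<and> Y \<subseteq> N' \<and> (step ^^ k) `` N' \<subseteq> N"
  proof (induction k)
    case 0
    then show ?case using N by (intro exI[of _ N]) auto
  next
    case (Suc k)
    then obtain N' where N': "openin X N'" "Y \<subseteq> N'" "(step ^^ k) `` N' \<subseteq> N" by blast
    obtain N'' where N'': "openin X N''" "Y \<subseteq> N''" "step `` N'' \<subseteq> N'"
      using step_near_saturated[OF Y N'(1,2)] .
    have "(step ^^ Suc k) `` N'' \<subseteq> N"
    proof clarify
      fix x y assume x: "x \<in> N''" "(x, y) \<in> step ^^ Suc k"
      then obtain w where "(x, w) \<in> step" "(w, y) \<in> step ^^ k" by (meson relpow_Suc_D2)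
      then show "y \<in> N" using x(1) N'(3) N''(3) by blast
    qed
    then show ?case using N'' by blast
  qed
  then show thesis using that by blast
qed

end

locale higson_leaf = regular_foliated X n \<A> \<U>
  for X :: "'a topology" and n :: nat and \<A> \<U> :: "('a, 'z) foliated_chart set" +
  fixes L :: "'a set" and K :: "'k topology" and \<iota> :: "'a \<Rightarrow> 'k"
  assumes leaf: "L \<in> leaves X n \<A>" and Higson: "Higson_compactification X n \<A> \<U> L K \<iota>"
begin

abbreviation "\<T>\<^sub>L \<equiv> subtopology \<T> L"

lemma topspace_leaf [simp]: "topspace \<T> \<inter> L = L"
  using leaf_subset[OF leaf] by (auto simp: topspace_leaf_topology)

lemma L_subset: "x \<in> L \<Longrightarrow> x \<in> topspace X"
  using leaf_subset[OF leaf] by blast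

section \<open>The leaf inside its compactification\<close>

lemma K_compact: "compact_space K" and K_Hausdorff: "Hausdorff_space K"
  and \<iota>_embedding: "embedding_map \<T>\<^sub>L K \<iota>" and \<iota>_open: "openin K (\<iota> ` L)"
  and \<iota>_dense: "K closure_of (\<iota> ` L) = topspace K"
  using Higson by (auto simp: Higson_compactification_def)

lemma extension_iff:
  fixes f :: "'a \<Rightarrow> complex"
  shows "(\<exists>F. continuous_map K euclidean F \<and> (\<forall>x \<in> L. F (\<iota> x) = f x)) \<longleftrightarrow>
    Higson_function X n \<A> \<U> L f \<and> continuous_map \<T>\<^sub>L euclidean f"
  using Higson by (auto simp: Higson_compactification_def)

lemma \<iota>_homeomorphic: "homeomorphic_map \<T>\<^sub>L (subtopology K (\<iota> ` L)) \<iota>"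
  using \<iota>_embedding by (simp add: embedding_map_def)

lemma \<iota>_continuous: "continuous_map \<T>\<^sub>L K \<iota>"
  using homeomorphic_imp_continuous_map[OF \<iota>_homeomorphic] by (simp add: continuous_map_in_subtopology)

lemma \<iota>_inj: "inj_on \<iota> L"
  using homeomorphic_imp_injective_map[OF \<iota>_homeomorphic] by simp

lemma \<iota>_in: "x \<in> L \<Longrightarrow> \<iota> x \<in> topspace K"
  using openin_subset[OF \<iota>_open] by blast

lemma \<iota>_image_open:
  assumes "openin \<T>\<^sub>L W"
  shows "openin K (\<iota> ` W)"
proof -
  have "openin (subtopology K (\<iota> ` L)) (\<iota> ` W)"
    using homeomorphic_imp_open_map[OF \<iota>_homeomorphic] assms by (auto simp: open_map_def)
  then show ?thesis using \<iota>_open by (simp add: openin_open_subtopology)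
qed

text \<open>Allows a compact part of the leaf to be removed from an open neighborhood of a corona
  point, which leaves an open neighborhood.\<close>

lemma \<iota>_image_closed:
  assumes "compactin \<T>\<^sub>L C"
  shows "closedin K (\<iota> ` C)"
  using compactin_imp_closedin[OF K_Hausdorff image_compactin[OF assms \<iota>_continuous]] .

abbreviation "\<nu>L \<equiv> topspace K - \<iota> ` L"

lemma neighbourhood_meets_leaf:
  assumes "openin K V" "e \<in> V"
  obtains x where "x \<in> L" "\<iota> x \<in> V"
proof -
  have "e \<in> K closure_of (\<iota> ` L)" using assms openin_subset \<iota>_dense by blast
  then show thesis using assms that by (auto simp: in_closure_of)
qed

text \<open>The restriction of \<open>F\<close> to the leaf is a Higson function. As the variation
  uses a strict bound on \<open>plaque_dist\<close>, the radius \<open>k + 1\<close> covers chains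
  of length \<open>k\<close>.\<close>

lemma extension_slowly_varying:
  fixes F :: "'k \<Rightarrow> complex"
  assumes F: "continuous_map K euclidean F" and \<epsilon>: "\<epsilon> > 0"
  obtains C where "compactin \<T>\<^sub>L C"
    "\<And>x y. x \<in> L - C \<Longrightarrow> (x, y) \<in> step ^^ k \<Longrightarrow> cmod (F (\<iota> x) - F (\<iota> y)) < \<epsilon>"
proof -
  define f where "f x = F (\<iota> x)" for x
  have "Higson_function X n \<A> \<U> L f" using extension_iff[of f] F by (auto simp: f_def)
  then have bdd: "bounded (f ` L)"
    and van: "vanishes_at_infinity \<T>\<^sub>L (leaf_variation X n \<A> \<U> L (real k + 1) f)"
    by (auto simp: Higson_function_def)
  obtain C where C: "compactin \<T>\<^sub>L C" "\<And>x. x \<in> L - C \<Longrightarrow> \<bar>leaf_variation X n \<A> \<U> L (real k + 1) f x\<bar> < \<epsilon>"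
    using van \<epsilon> by (auto simp: vanishes_at_infinity_def)
  have "cmod (f x - f y) < \<epsilon>" if x: "x \<in> L - C" and y: "(x, y) \<in> step ^^ k" for x y
  proof -
    let ?S = "{cmod (f x - f y) | y. y \<in> L \<and> real (plaque_dist X n \<A> \<U> x y) < real k + 1}"
    obtain B where B: "\<And>z. z \<in> L \<Longrightarrow> cmod (f z) \<le> B" using bdd by (auto simp: bounded_iff)
    \<comment> \<open>Boundedness of \<open>f\<close> makes the supremum in
      \<open>leaf_variation\<close> an actual upper bound.\<close>
    have "bdd_above ?S"
    proof (rule bdd_aboveI[of _ "B + B"], clarify)
      fix z assume "z \<in> L"
      then show "cmod (f x - f z) \<le> B + B"
        using norm_triangle_ineq4[of "f x" "f z"] B[of x] B[of z] x by auto
    qed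
    moreover have "y \<in> L" using leaf_relpow[OF leaf _ y] x by blast
    moreover have "real (plaque_dist X n \<A> \<U> x y) < real k + 1" using plaque_dist_le[OF y] by simp
    ultimately have "cmod (f x - f y) \<le> leaf_variation X n \<A> \<U> L (real k + 1) f x"
      unfolding leaf_variation_def by (intro cSup_upper) auto
    then show ?thesis using C(2)[OF x] by linarith
  qed
  then show thesis using that[OF C(1)] by (simp add: f_def)
qed

text \<open>This is where the slow variation of Higson functions enters.\<close>

lemma corona_neighbourhood_shrink:
  assumes e: "e \<in> \<nu>L" and V: "openin K V" "e \<in> V"
  obtains V' where "openin K V'" "e \<in> V'"
    "\<And>x y. x \<in> L \<Longrightarrow> \<iota> x \<in> V' \<Longrightarrow> (x, y) \<in> step ^^ k \<Longrightarrow> \<iota> y \<in> V"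
proof -
  have "completely_regular_space K"
    using normal_imp_completely_regular_space compact_Hausdorff_or_regular_imp_normal_space
      K_compact K_Hausdorff by blast
  moreover have "closedin K (topspace K - V)" using V(1) by (intro closedin_diff) auto
  moreover have "e \<in> topspace K - (topspace K - V)" using e V(2) by blast
  ultimately obtain f :: "'k \<Rightarrow> real" where f: "continuous_map K (top_of_set {0..1}) f" "f e = 0"
    "f ` (topspace K - V) \<subseteq> {1}"
    unfolding completely_regular_space_def by meson
  have fc: "continuous_map K euclideanreal f" using f(1) by (simp add: continuous_map_in_subtopology)
  have "continuous_map K euclidean (\<lambda>x. complex_of_real (f x))"
    using continuous_map_compose[OF fc, of euclidean complex_of_real]
    by (simp add: o_def continuous_on_of_real)
  from extension_slowly_varying[OF this, of "1/2" k] obtain C where C: "compactin \<T>\<^sub>L C"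
    "\<And>x y. x \<in> L - C \<Longrightarrow> (x, y) \<in> step ^^ k \<Longrightarrow> \<bar>f (\<iota> x) - f (\<iota> y)\<bar> < 1/2"
    by (auto simp flip: of_real_diff)
  \<comment> \<open>Starting below 1/2 and changing by less than 1/2, \<open>f\<close> cannot reach
    the value 1 that it takes off \<open>V\<close>. Outside \<open>C\<close> the change is that
    small.\<close>
  let ?V = "{z \<in> topspace K. f z \<in> {..<1/2}} - \<iota> ` C"
  have CL: "C \<subseteq> L" using compactin_subset_topspace[OF C(1)] by simp
  show thesis
  proof (rule that[of ?V])
    show "openin K ?V"
      by (intro openin_diff openin_continuous_map_preimage[OF fc] \<iota>_image_closed C(1)) simp
    show "e \<in> ?V" using e f(2) CL by auto
    fix x y assume x: "x \<in> L" "\<iota> x \<in> ?V" and y: "(x, y) \<in> step ^^ k"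
    then have "x \<in> L - C" by blast
    from C(2)[OF this y] have "f (\<iota> y) \<noteq> 1" using x(2) by auto
    moreover have "\<iota> y \<in> topspace K" using \<iota>_in leaf_relpow[OF leaf x(1) y] by blast
    ultimately show "\<iota> y \<in> V" using f(3) by blast
  qed
qed

lemma in_leaf_limit_iff:
  assumes "e \<in> topspace K"
  shows "y \<in> leaf_limit X L K \<iota> e \<longleftrightarrow>
    (\<forall>V. openin K V \<longrightarrow> e \<in> V \<longrightarrow> y \<in> X closure_of {x \<in> L. \<iota> x \<in> V})"
proof
  assume y: "y \<in> leaf_limit X L K \<iota> e"
  show "\<forall>V. openin K V \<longrightarrow> e \<in> V \<longrightarrow> y \<in> X closure_of {x \<in> L. \<iota> x \<in> V}"
  proof (intro allI impI)
    fix V assume "openin K V" "e \<in> V"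
    then have "V \<in> neighborhoods_of K e" unfolding neighborhoods_of_def using openin_subset by blast
    then show "y \<in> X closure_of {x \<in> L. \<iota> x \<in> V}" using y unfolding leaf_limit_def by blast
  qed
next
  assume y: "\<forall>V. openin K V \<longrightarrow> e \<in> V \<longrightarrow> y \<in> X closure_of {x \<in> L. \<iota> x \<in> V}"
  show "y \<in> leaf_limit X L K \<iota> e"
    unfolding leaf_limit_def
  proof
    fix V assume "V \<in> neighborhoods_of K e"
    then obtain W where W: "openin K W" "e \<in> W" "W \<subseteq> V" unfolding neighborhoods_of_def by blast
    have "X closure_of {x \<in> L. \<iota> x \<in> W} \<subseteq> X closure_of {x \<in> L. \<iota> x \<in> V}"
      using W(3) by (intro closure_of_mono) blast
    then show "y \<in> X closure_of {x \<in> L. \<iota> x \<in> V}" using y W(1,2) by blast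
  qed
qed

lemma leaf_limit_alt:
  assumes "e \<in> topspace K"
  shows "leaf_limit X L K \<iota> e = \<Inter>((\<lambda>V. X closure_of {x \<in> L. \<iota> x \<in> V}) ` {V. openin K V \<and> e \<in> V})"
  by (intro set_eqI) (simp add: in_leaf_limit_iff[OF assms] imp_conjL)

lemma leaf_limit_closed:
  assumes "e \<in> topspace K"
  shows "closedin X (leaf_limit X L K \<iota> e)"
  unfolding leaf_limit_alt[OF assms] using assms by (intro closedin_Inter) auto

lemma leaf_limit_nonempty:
  assumes e: "e \<in> topspace K"
  shows "leaf_limit X L K \<iota> e \<noteq> {}"
  unfolding leaf_limit_alt[OF assms]
proof (rule compact_space_directed_Inter[OF compact])
  let ?C = "(\<lambda>V. X closure_of {x \<in> L. \<iota> x \<in> V}) ` {V. openin K V \<and> e \<in> V}"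
  show "?C \<noteq> {}" using e by blast
  show "closedin X C \<and> C \<noteq> {}" if C: "C \<in> ?C" for C
  proof -
    obtain V where V: "openin K V" "e \<in> V" "C = X closure_of {x \<in> L. \<iota> x \<in> V}" using C by blast
    obtain x where x: "x \<in> L" "\<iota> x \<in> V" using neighbourhood_meets_leaf[OF V(1,2)] .
    have "{x \<in> L. \<iota> x \<in> V} \<subseteq> topspace X" using L_subset by blast
    from closure_of_subset[OF this] show ?thesis using x V(3) by auto
  qed
  fix C D assume "C \<in> ?C" "D \<in> ?C"
  then obtain V W where VW: "openin K V" "e \<in> V" "C = X closure_of {x \<in> L. \<iota> x \<in> V}"
    "openin K W" "e \<in> W" "D = X closure_of {x \<in> L. \<iota> x \<in> W}" by blast
  have "X closure_of {x \<in> L. \<iota> x \<in> V \<inter> W} \<subseteq> C \<inter> D"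
    unfolding VW(3,6) by (intro Int_greatest closure_of_mono) auto
  moreover have "openin K (V \<inter> W)" using VW by blast
  ultimately show "\<exists>E\<in>?C. E \<subseteq> C \<inter> D" using VW(2,5) by blast
qed

text \<open>Let \<open>y\<close> be in the limit set and \<open>z\<close> one step away. Leaf points
  near \<open>y\<close> with image in \<open>V'\<close> can step close to \<open>z\<close>, and
  \<open>corona_neighbourhood_shrink\<close> keeps the images of the endpoints in
  \<open>V\<close>.\<close>

lemma leaf_limit_saturated:
  assumes e: "e \<in> \<nu>L"
  shows "saturated X n \<A> (leaf_limit X L K \<iota> e)"
  unfolding saturated_iff
proof (intro conjI subsetI)
  have eK: "e \<in> topspace K" using e by blast
  show "x \<in> topspace X" if "x \<in> leaf_limit X L K \<iota> e" for x
    using closedin_subset[OF leaf_limit_closed[OF eK]] that by blast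
  fix z assume "z \<in> step `` leaf_limit X L K \<iota> e"
  then obtain y where y: "y \<in> leaf_limit X L K \<iota> e" "(y, z) \<in> step" by blast
  show "z \<in> leaf_limit X L K \<iota> e"
    unfolding in_leaf_limit_iff[OF eK]
  proof (intro allI impI)
    fix V assume V: "openin K V" "e \<in> V"
    obtain V' where V': "openin K V'" "e \<in> V'"
      "\<And>x y. x \<in> L \<Longrightarrow> \<iota> x \<in> V' \<Longrightarrow> (x, y) \<in> step ^^ 1 \<Longrightarrow> \<iota> y \<in> V"
      using corona_neighbourhood_shrink[OF e V, of 1] by blast
    have ycl: "y \<in> X closure_of {x \<in> L. \<iota> x \<in> V'}"
      using y(1) V'(1,2) in_leaf_limit_iff[OF eK] by blast
    show "z \<in> X closure_of {x \<in> L. \<iota> x \<in> V}"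
      unfolding in_closure_of
    proof (intro conjI allI impI)
      show "z \<in> topspace X" using step_in[OF y(2)] by blast
      fix N assume N: "z \<in> N \<and> openin X N"
      obtain M where M: "openin X M" "y \<in> M" "\<And>x'. x' \<in> M \<Longrightarrow> \<exists>y'\<in>N. (x', y') \<in> step"
        using step_transversal[OF y(2)] N by metis
      obtain x' where x': "x' \<in> L" "\<iota> x' \<in> V'" "x' \<in> M"
        using ycl M(1,2) unfolding in_closure_of by blast
      obtain y' where y': "y' \<in> N" "(x', y') \<in> step" using M(3)[OF x'(3)] by blast
      have "y' \<in> L" using leaf_step[OF leaf x'(1) y'(2)] .
      moreover have "\<iota> y' \<in> V" using V'(3)[OF x'(1,2)] y'(2) by simp
      ultimately show "\<exists>y. y \<in> {x \<in> L. \<iota> x \<in> V} \<and> y \<in> N" using y'(1) by blast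
    qed
  qed
qed

end

section \<open>Slowly varying functions\<close>

definition weighted_mean :: "(('a \<Rightarrow> real) \<times> ('a \<Rightarrow> 'a)) set \<Rightarrow> ('a \<Rightarrow> real) \<Rightarrow> 'a \<Rightarrow> real" where
  "weighted_mean J g x = (\<Sum>(u, r)\<in>J. u x * g (r x)) / (\<Sum>(u, r)\<in>J. u x)"

lemma weighted_mean_bounds:
  assumes nonneg: "\<And>u r. (u, r) \<in> J \<Longrightarrow> u x \<ge> 0" and pos: "(\<Sum>(u, r)\<in>J. u x) > 0"
    and g: "\<And>u r. (u, r) \<in> J \<Longrightarrow> u x > 0 \<Longrightarrow> a \<le> g (r x) \<and> g (r x) \<le> b"
  shows "a \<le> weighted_mean J g x" "weighted_mean J g x \<le> b"
proof -
  have *: "u x * a \<le> u x * g (r x) \<and> u x * g (r x) \<le> u x * b" if "(u, r) \<in> J" for u r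
    using nonneg[OF that] g[OF that] by (cases "u x = 0") (auto intro: mult_left_mono)
  have "(\<Sum>(u, r)\<in>J. u x) * a = (\<Sum>(u, r)\<in>J. u x * a)"
    by (simp add: sum_distrib_right case_prod_unfold)
  also have "\<dots> \<le> (\<Sum>(u, r)\<in>J. u x * g (r x))"
    using * by (intro sum_mono) auto
  finally show "a \<le> weighted_mean J g x"
    using pos by (simp add: weighted_mean_def pos_le_divide_eq mult.commute)
  have "(\<Sum>(u, r)\<in>J. u x * g (r x)) \<le> (\<Sum>(u, r)\<in>J. u x * b)"
    using * by (intro sum_mono) auto
  also have "\<dots> = (\<Sum>(u, r)\<in>J. u x) * b"
    by (simp add: sum_distrib_right case_prod_unfold)
  finally show "weighted_mean J g x \<le> b"
    using pos by (simp add: weighted_mean_def pos_divide_le_eq mult.commute)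
qed

lemma continuous_map_weighted_mean:
  assumes J: "finite J" "\<And>u r g. (u, r) \<in> J \<Longrightarrow> continuous_map T euclideanreal (\<lambda>x. u x * g (r x))"
    and pos: "\<And>x. x \<in> topspace T \<Longrightarrow> (\<Sum>(u, r)\<in>J. u x) > 0"
  shows "continuous_map T euclideanreal (weighted_mean J g)"
proof -
  have *: "continuous_map T euclideanreal (\<lambda>x. \<Sum>(u, r)\<in>J. u x * g (r x))" for g
    unfolding case_prod_unfold using J by (intro continuous_map_sum) auto
  show ?thesis
    unfolding weighted_mean_def[abs_def]
  proof (rule continuous_map_real_divide)
    show "continuous_map T euclideanreal (\<lambda>x. \<Sum>(u, r)\<in>J. u x)" using *[of "\<lambda>_. 1"] by simp
    show "(\<Sum>(u, r)\<in>J. u x) \<noteq> 0" if "x \<in> topspace T" for x using pos[OF that] by simp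
  qed (rule *)
qed

context regular_foliated
begin

text \<open>Within a leaf this is the distance in the graph of \<open>step\<close>. For points that
  no chain joins, \<open>LEAST\<close> carries no information.\<close>

definition chain_dist :: "'a \<Rightarrow> 'a \<Rightarrow> nat" where
  "chain_dist x y = (LEAST k. (x, y) \<in> step ^^ k)"

lemma chain_dist_le: "(x, y) \<in> step ^^ k \<Longrightarrow> chain_dist x y \<le> k"
  unfolding chain_dist_def by (rule Least_le)

end

context higson_leaf
begin

lemma relpow_chain_dist:
  assumes "x \<in> L" "y \<in> L"
  shows "(x, y) \<in> step ^^ chain_dist x y"
  unfolding chain_dist_def by (rule leaf_chain[OF leaf assms]) (rule LeastI)

lemma chain_dist_le_iff:
  assumes "x \<in> L" "y \<in> L"
  shows "chain_dist x y \<le> k \<longleftrightarrow> (x, y) \<in> step ^^ k"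
  using relpow_step_mono[OF relpow_chain_dist[OF assms] _ L_subset[OF assms(1)]] chain_dist_le by blast

text \<open>A tent of height 1 whose radius \<open>Suc k\<close> is the inverse of its slope; the
  successor avoids division by zero at \<open>k = 0\<close>.\<close>

definition bump :: "(nat \<Rightarrow> 'a) \<Rightarrow> nat \<Rightarrow> 'a \<Rightarrow> real" where
  "bump y k x = max 0 (1 - real (chain_dist (y k) x) / real (Suc k))"

text \<open>A supremum instead of a sum: where supports overlap, the common bound 1 and uniform
  estimates on the single bumps carry over unchanged.\<close>

definition bumps :: "(nat \<Rightarrow> 'a) \<Rightarrow> 'a \<Rightarrow> real" where
  "bumps y x = (SUP k. bump y k x)"

lemma bump_bounds: "0 \<le> bump y k x" "bump y k x \<le> 1"
  by (simp_all add: bump_def)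

lemma bdd_above_bump: "bdd_above (range (\<lambda>k. bump y k x))"
  using bump_bounds(2) by (intro bdd_aboveI[of _ 1]) blast

lemma bump_le_bumps: "bump y k x \<le> bumps y x"
  unfolding bumps_def by (rule cSUP_upper[OF UNIV_I bdd_above_bump])

lemma bumps_le: "(\<And>k. bump y k x \<le> b) \<Longrightarrow> bumps y x \<le> b"
  unfolding bumps_def by (rule cSUP_least) auto

lemma bump_eq_0_iff: "bump y k x = 0 \<longleftrightarrow> Suc k \<le> chain_dist (y k) x"
  by (simp add: bump_def max_def le_divide_eq flip: of_nat_Suc)

context
  fixes y :: "nat \<Rightarrow> 'a"
  assumes y: "\<And>k. y k \<in> L"
begin

lemma bumps_pos:
  assumes x: "x \<in> L" and pos: "bumps y x > 0"
  obtains k where "(y k, x) \<in> step ^^ k"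
proof -
  have "\<exists>k. bump y k x > 0"
  proof (rule ccontr)
    assume "\<not> ?thesis"
    then have "bumps y x \<le> 0" by (intro bumps_le) (simp add: not_less)
    then show False using pos by simp
  qed
  then obtain k where "bump y k x \<noteq> 0" by force
  then have "chain_dist (y k) x \<le> k" by (simp add: bump_eq_0_iff)
  then show thesis using that chain_dist_le_iff[OF y x] by blast
qed

lemma bump_lipschitz:
  assumes x: "x \<in> L" and xz: "(x, z) \<in> step ^^ R"
  shows "bump y k x \<le> bump y k z + real R / real (Suc k)"
proof -
  have "(y k, z) \<in> step ^^ (chain_dist (y k) x + R)"
    by (rule relpow_step_trans[OF relpow_chain_dist[OF y x] xz])
  then have "real (chain_dist (y k) z) \<le> real (chain_dist (y k) x) + real R"
    using chain_dist_le by (metis of_nat_add of_nat_mono)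
  then have "real (chain_dist (y k) z) / real (Suc k)
      \<le> real (chain_dist (y k) x) / real (Suc k) + real R / real (Suc k)"
    by (simp add: divide_right_mono flip: add_divide_distrib)
  moreover have "real R / real (Suc k) \<ge> 0" by simp
  ultimately show ?thesis unfolding bump_def by linarith
qed

text \<open>Bumps of large index are flat and change little over \<open>R\<close> steps. The
  finitely many steep ones vanish at all points within \<open>R\<close> steps of \<open>x\<close>
  once \<open>x\<close> is outside a compact set.\<close>

lemma bumps_slowly_varying:
  assumes \<epsilon>: "\<epsilon> > 0"
  obtains C where "compactin \<T>\<^sub>L C"
    "\<And>x z. x \<in> L - C \<Longrightarrow> (x, z) \<in> step ^^ R \<Longrightarrow> \<bar>bumps y x - bumps y z\<bar> \<le> \<epsilon>"
proof -
  \<comment> \<open>From index \<open>m\<close> on, a change of \<open>R / (k + 1)\<close> is at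
    most \<epsilon>.\<close>
  obtain m :: nat where m: "real R / \<epsilon> < real m" using reals_Archimedean2 by blast
  \<comment> \<open>Beyond \<open>R + Suc k\<close> steps from \<open>y k\<close>, both
    \<open>x\<close> and any point within \<open>R\<close> steps of it are outside the support,
    whose radius is \<open>Suc k\<close>.\<close>
  have "\<forall>k. \<exists>C. compactin \<T>\<^sub>L C \<and> (step ^^ (R + Suc k)) `` {y k} \<subseteq> C"
    using relpow_step_relatively_compact[OF leaf y] by metis
  then obtain C where C: "\<And>k. compactin \<T>\<^sub>L (C k)" "\<And>k. (step ^^ (R + Suc k)) `` {y k} \<subseteq> C k"
    by metis
  have near: "bump y k x \<le> bump y k z + \<epsilon>" "bump y k z \<le> bump y k x + \<epsilon>"
    if x: "x \<in> L" "x \<notin> (\<Union>k<m. C k)" and xz: "(x, z) \<in> step ^^ R" for x z k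
  proof -
    have z: "z \<in> L" using leaf_relpow[OF leaf x(1) xz] .
    have zx: "(z, x) \<in> step ^^ R" using relpow_step_sym[OF xz] .
    have "bump y k x \<le> bump y k z + \<epsilon> \<and> bump y k z \<le> bump y k x + \<epsilon>"
    proof (cases "k < m")
      case True
      then have "(y k, x) \<notin> step ^^ (R + Suc k)" using x(2) C(2)[of k] by blast
      then have far: "\<not> chain_dist (y k) x \<le> R + Suc k" using chain_dist_le_iff[OF y x(1)] by blast
      have "chain_dist (y k) x \<le> chain_dist (y k) z + R"
        by (rule chain_dist_le[OF relpow_step_trans[OF relpow_chain_dist[OF y z] zx]])
      then have "Suc k \<le> chain_dist (y k) z" "Suc k \<le> chain_dist (y k) x" using far by linarith+
      then have "bump y k x = 0" "bump y k z = 0" by (simp_all add: bump_eq_0_iff)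
      then show ?thesis using \<epsilon> by simp
    next
      case False
      then have "real R / \<epsilon> \<le> real (Suc k)" using m by linarith
      then have "real R / real (Suc k) \<le> \<epsilon>" using \<epsilon> by (simp add: field_simps)
      then show ?thesis using bump_lipschitz[OF x(1) xz, of k] bump_lipschitz[OF z zx, of k] by linarith
    qed
    then show "bump y k x \<le> bump y k z + \<epsilon>" "bump y k z \<le> bump y k x + \<epsilon>" by blast+
  qed
  show thesis
  proof (rule that[of "\<Union>k<m. C k"])
    show "compactin \<T>\<^sub>L (\<Union>k<m. C k)" using C(1) by (intro compactin_Union) auto
    fix x z assume x: "x \<in> L - (\<Union>k<m. C k)" and xz: "(x, z) \<in> step ^^ R"
    then have x': "x \<in> L" "x \<notin> (\<Union>k<m. C k)" by blast+
    have "bumps y x \<le> bumps y z + \<epsilon>"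
      using near(1)[OF x' xz] bump_le_bumps[of y _ z] by (intro bumps_le) (meson add_right_mono order_trans)
    moreover have "bumps y z \<le> bumps y x + \<epsilon>"
      using near(2)[OF x' xz] bump_le_bumps[of y _ x] by (intro bumps_le) (meson add_right_mono order_trans)
    ultimately show "\<bar>bumps y x - bumps y z\<bar> \<le> \<epsilon>" by linarith
  qed
qed

text \<open>
  The function \<^const>\<open>bumps\<close> varies slowly but is not continuous, as \<^const>\<open>chain_dist\<close> is integer-valued.
  Averaging it over the plaques through a point repairs this.
\<close>

lemma smooth_bumps:
  obtains h :: "'a \<Rightarrow> real" where "continuous_map \<T> euclideanreal h"
    "\<And>x. x \<in> L \<Longrightarrow> 0 \<le> h x \<and> h x \<le> 1"
    "\<And>k. h (y k) \<ge> 1 - 1 / real (Suc k)"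
    "\<And>x. x \<in> L \<Longrightarrow> h x > 0 \<Longrightarrow> \<exists>k. (y k, x) \<in> step ^^ Suc k"
    "\<And>R \<epsilon>. \<epsilon> > 0 \<Longrightarrow> \<exists>C. compactin \<T>\<^sub>L C \<and>
      (\<forall>x \<in> L - C. \<forall>z. (x, z) \<in> step ^^ R \<longrightarrow> \<bar>h x - h z\<bar> \<le> \<epsilon>)"
proof (rule plaque_partition)
  fix J :: "(('a \<Rightarrow> real) \<times> ('a \<Rightarrow> 'a)) set"
  assume J: "finite J" "\<And>u r x. (u, r) \<in> J \<Longrightarrow> u x \<ge> 0"
    "\<And>u r x. (u, r) \<in> J \<Longrightarrow> x \<in> topspace X \<Longrightarrow> u x > 0 \<Longrightarrow> (x, r x) \<in> step"
    "\<And>u r g. (u, r) \<in> J \<Longrightarrow> continuous_map \<T> euclideanreal (\<lambda>x. u x * g (r x))"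
    "\<And>x. x \<in> topspace X \<Longrightarrow> (\<Sum>(u, r)\<in>J. u x) > 0"
  let ?h = "weighted_mean J (bumps y)"
  \<comment> \<open>The mean at \<open>x\<close> only samples points one step from \<open>x\<close>;
    this is the plaque of room lost in the estimates below.\<close>
  have mean: "a \<le> ?h x \<and> ?h x \<le> b"
    if x: "x \<in> L" and ab: "\<And>z. (x, z) \<in> step \<Longrightarrow> a \<le> bumps y z \<and> bumps y z \<le> b" for x a b
  proof -
    have "0 \<le> u x" if "(u, r) \<in> J" for u r using J(2)[OF that] .
    moreover have "a \<le> bumps y (r x) \<and> bumps y (r x) \<le> b" if "(u, r) \<in> J" "u x > 0" for u r
      using ab[OF J(3)[OF that(1) L_subset[OF x] that(2)]] .
    ultimately show ?thesis
      using weighted_mean_bounds[of J x a "bumps y" b] J(5)[OF L_subset[OF x]] by blast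
  qed
  show thesis
  proof (rule that[of ?h])
    show "continuous_map \<T> euclideanreal ?h"
      using J(1,4,5) by (intro continuous_map_weighted_mean) (simp_all add: topspace_leaf_topology)
    show "0 \<le> ?h x \<and> ?h x \<le> 1" if x: "x \<in> L" for x
    proof (rule mean[OF x])
      fix z
      show "0 \<le> bumps y z \<and> bumps y z \<le> 1"
        using order_trans[OF bump_bounds(1) bump_le_bumps] bumps_le[OF bump_bounds(2)] by blast
    qed
    show "1 - 1 / real (Suc k) \<le> ?h (y k)" for k
    proof -
      have "1 - 1 / real (Suc k) \<le> bumps y z \<and> bumps y z \<le> 1" if z: "(y k, z) \<in> step" for z
      proof -
        have "chain_dist (y k) z \<le> 1" using chain_dist_le[of "y k" z 1] z by simp
        then have "real (chain_dist (y k) z) / real (Suc k) \<le> 1 / real (Suc k)"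
          by (intro divide_right_mono) auto
        then have "1 - 1 / real (Suc k) \<le> bump y k z" unfolding bump_def by linarith
        also have "\<dots> \<le> bumps y z" by (rule bump_le_bumps)
        finally show ?thesis using bumps_le[OF bump_bounds(2)] by blast
      qed
      then show ?thesis using mean[OF y] by blast
    qed
    \<comment> \<open>Averaging enlarges each support by one step, hence \<open>Suc k\<close> in
      place of the \<open>k\<close> of \<open>bumps_pos\<close>.\<close>
    show "\<exists>k. (y k, x) \<in> step ^^ Suc k" if x: "x \<in> L" and pos: "?h x > 0" for x
    proof (rule ccontr)
      assume no: "\<not> ?thesis"
      have "0 \<le> bumps y z \<and> bumps y z \<le> 0" if z: "(x, z) \<in> step" for z
      proof -
        have "\<not> bumps y z > 0"
        proof
          assume "bumps y z > 0"
          then obtain k where "(y k, z) \<in> step ^^ k" using bumps_pos leaf_step[OF leaf x z] by blast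
          then have "(y k, x) \<in> step ^^ Suc k" using symD[OF sym_step z] by auto
          then show False using no by blast
        qed
        then show ?thesis using order_trans[OF bump_bounds(1) bump_le_bumps, of y z] by linarith
      qed
      from mean[OF x this] pos show False by linarith
    qed
    show "\<exists>C. compactin \<T>\<^sub>L C \<and> (\<forall>x \<in> L - C. \<forall>z. (x, z) \<in> step ^^ R \<longrightarrow> \<bar>?h x - ?h z\<bar> \<le> \<epsilon>)"
      if \<epsilon>: "\<epsilon> > 0" for R \<epsilon>
    proof -
      \<comment> \<open>\<open>Suc R\<close> because the mean at a point \<open>R\<close> steps away
        samples one step further; \<open>\<epsilon> / 2\<close> because both means are compared with
        \<open>bumps y x\<close>.\<close>
      obtain C where C: "compactin \<T>\<^sub>L C"
        "\<And>x z. x \<in> L - C \<Longrightarrow> (x, z) \<in> step ^^ Suc R \<Longrightarrow> \<bar>bumps y x - bumps y z\<bar> \<le> \<epsilon> / 2"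
        using bumps_slowly_varying[of "\<epsilon> / 2" "Suc R"] \<epsilon> by auto
      have "\<bar>?h x - ?h z\<bar> \<le> \<epsilon>" if x: "x \<in> L - C" and xz: "(x, z) \<in> step ^^ R" for x z
      proof -
        have xL: "x \<in> L" and zL: "z \<in> L" using x leaf_relpow[OF leaf _ xz] by blast+
        have "bumps y x - \<epsilon> / 2 \<le> ?h w \<and> ?h w \<le> bumps y x + \<epsilon> / 2"
          if w: "w \<in> L" "(x, w) \<in> step ^^ R" for w
        proof (rule mean[OF w(1)])
          fix v assume "(w, v) \<in> step"
          then have "(x, v) \<in> step ^^ Suc R" using w(2) by auto
          from C(2)[OF x this] show "bumps y x - \<epsilon> / 2 \<le> bumps y v \<and> bumps y v \<le> bumps y x + \<epsilon> / 2"
            by linarith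
        qed
        moreover have "(x, x) \<in> step ^^ R"
          using relpow_step_mono[of x x 0 R] L_subset[OF xL] by simp
        ultimately have "bumps y x - \<epsilon> / 2 \<le> ?h x \<and> ?h x \<le> bumps y x + \<epsilon> / 2"
          "bumps y x - \<epsilon> / 2 \<le> ?h z \<and> ?h z \<le> bumps y x + \<epsilon> / 2" using xL zL xz by blast+
        then show ?thesis by linarith
      qed
      then show ?thesis using C(1) by blast
    qed
  qed
qed

end

text \<open>Slow variation along chains implies the Higson property by the quadratic comparison with
  \<open>plaque_dist\<close>. Higson functions are complex-valued, so \<open>h\<close> is viewed in
  the complex numbers and the real part of the extension is taken.\<close>

lemma slowly_varying_extends:
  assumes cont: "continuous_map \<T> euclideanreal h" and bdd: "\<And>x. x \<in> L \<Longrightarrow> 0 \<le> h x \<and> h x \<le> 1"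
    and slow: "\<And>R \<epsilon>. \<epsilon> > 0 \<Longrightarrow> \<exists>C. compactin \<T>\<^sub>L C \<and>
      (\<forall>x \<in> L - C. \<forall>z. (x, z) \<in> step ^^ R \<longrightarrow> \<bar>h x - h z\<bar> \<le> \<epsilon>)"
  obtains H where "continuous_map K euclideanreal H" "\<And>x. x \<in> L \<Longrightarrow> H (\<iota> x) = h x"
proof -
  define f where "f x = complex_of_real (h x)" for x
  have "vanishes_at_infinity \<T>\<^sub>L (leaf_variation X n \<A> \<U> L R f)" if R: "R > 0" for R
    unfolding vanishes_at_infinity_def
  proof (intro allI impI)
    fix \<epsilon> :: real assume \<epsilon>: "\<epsilon> > 0"
    \<comment> \<open>A \<open>plaque_dist\<close> below \<open>R\<close> is at most
      \<open>m\<close>, so chains of length \<open>Suc (m * m)\<close> suffice. The bound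
      \<open>\<epsilon> / 2\<close> below keeps the supremum strictly below \<epsilon>.\<close>
    define m where "m = nat \<lceil>R\<rceil>"
    obtain C where C: "compactin \<T>\<^sub>L C"
      "\<And>x z. x \<in> L - C \<Longrightarrow> (x, z) \<in> step ^^ Suc (m * m) \<Longrightarrow> \<bar>h x - h z\<bar> \<le> \<epsilon> / 2"
      using slow[of "\<epsilon> / 2" "Suc (m * m)"] \<epsilon> by auto
    have "\<bar>leaf_variation X n \<A> \<U> L R f x\<bar> < \<epsilon>" if x: "x \<in> L - C" for x
    proof -
      let ?S = "{cmod (f x - f z) | z. z \<in> L \<and> real (plaque_dist X n \<A> \<U> x z) < R}"
      have le: "s \<le> \<epsilon> / 2" if s: "s \<in> ?S" for s
      proof -
        obtain z where z: "s = cmod (f x - f z)" "z \<in> L" "real (plaque_dist X n \<A> \<U> x z) < R"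
          using s by blast
        then have "plaque_dist X n \<A> \<U> x z \<le> m" unfolding m_def by linarith
        then obtain j where "j \<le> Suc (m * m)" "(x, z) \<in> step ^^ j"
          using plaque_dist_chain[OF leaf _ z(2)] x by blast
        then have "(x, z) \<in> step ^^ Suc (m * m)" using relpow_step_mono L_subset x by blast
        from C(2)[OF x this] show ?thesis using z(1) by (simp add: f_def flip: of_real_diff)
      qed
      \<comment> \<open>The choice \<open>z = x\<close> makes the set nonempty and its supremum
        nonnegative.\<close>
      have "cmod (f x - f x) \<in> ?S" using x R by (auto simp: plaque_dist_def)
      then have 0: "0 \<in> ?S" by simp
      have "bdd_above ?S" using le by (rule bdd_aboveI)
      from cSup_upper[OF 0 this] have "0 \<le> leaf_variation X n \<A> \<U> L R f x"
        unfolding leaf_variation_def .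
      moreover have "leaf_variation X n \<A> \<U> L R f x \<le> \<epsilon> / 2"
        unfolding leaf_variation_def using 0 le by (intro cSup_least) blast+
      ultimately show ?thesis using \<epsilon> by linarith
    qed
    then show "\<exists>C. compactin \<T>\<^sub>L C \<and>
        (\<forall>x\<in>topspace \<T>\<^sub>L - C. \<bar>leaf_variation X n \<A> \<U> L R f x\<bar> < \<epsilon>)"
      using C(1) by auto
  qed
  moreover have "bounded (f ` L)"
    using bdd by (intro boundedI[of _ 1]) (auto simp: f_def)
  ultimately have "Higson_function X n \<A> \<U> L f" by (simp add: Higson_function_def)
  moreover have "continuous_map \<T>\<^sub>L euclidean f"
    using continuous_map_compose[OF continuous_map_from_subtopology[OF cont], of euclidean complex_of_real]
    by (simp add: o_def f_def[abs_def] continuous_on_of_real)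
  ultimately obtain F where F: "continuous_map K euclidean F" "\<forall>x \<in> L. F (\<iota> x) = f x"
    using extension_iff[of f] by blast
  have "continuous_map K euclideanreal (\<lambda>z. Re (F z))"
    using continuous_map_compose[OF F(1), of euclidean Re] by (simp add: o_def continuous_on_Re)
  then show thesis using that[of "\<lambda>z. Re (F z)"] F(2) by (simp add: f_def)
qed

end

section \<open>Density\<close>

context higson_leaf
begin

text \<open>The compact set \<open>C\<close> holds all points within \<open>k\<close> steps of
  \<open>p\<close>; deleting its image from \<open>V\<close> leaves a neighborhood of
  \<open>e\<close>, whose leaf points still accumulate on \<open>Y\<close>. \<open>N'\<close> is so
  close to \<open>Y\<close> that \<open>Suc k\<close> steps from it end in \<open>N\<close>; this is
  the support radius of the averaged \<open>k\<close>-th bump.\<close>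

lemma leaf_point_near_saturated:
  assumes e: "e \<in> \<nu>L" and V: "openin K V" "e \<in> V" and p: "p \<in> L"
    and Y: "Y \<subseteq> leaf_limit X L K \<iota> e" "Y \<noteq> {}" "saturated X n \<A> Y" and N: "openin X N" "Y \<subseteq> N"
  shows "\<exists>y. y \<in> L \<and> \<iota> y \<in> V \<and> (p, y) \<notin> step ^^ k \<and> (step ^^ Suc k) `` {y} \<subseteq> N"
proof -
  obtain C where C: "compactin \<T>\<^sub>L C" "(step ^^ k) `` {p} \<subseteq> C"
    using relpow_step_relatively_compact[OF leaf p] .
  have CL: "C \<subseteq> L" using compactin_subset_topspace[OF C(1)] by simp
  obtain N' where N': "openin X N'" "Y \<subseteq> N'" "(step ^^ Suc k) `` N' \<subseteq> N"
    using relpow_step_near_saturated[OF Y(3) N] .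
  obtain y0 where y0: "y0 \<in> Y" using Y(2) by blast
  have "openin K (V - \<iota> ` C)" using V(1) \<iota>_image_closed[OF C(1)] by (rule openin_diff)
  moreover have "e \<in> V - \<iota> ` C" using e V(2) CL by blast
  moreover have "e \<in> topspace K" "y0 \<in> leaf_limit X L K \<iota> e" using e y0 Y(1) by blast+
  ultimately have "y0 \<in> X closure_of {x \<in> L. \<iota> x \<in> V - \<iota> ` C}" using in_leaf_limit_iff by blast
  then obtain y where y: "y \<in> L" "\<iota> y \<in> V - \<iota> ` C" "y \<in> N'"
    using N'(1,2) y0 unfolding in_closure_of by blast
  then have "y \<notin> C" by blast
  then show ?thesis using y C(2) N'(3) by blast
qed

text \<open>
  The points \<open>y k\<close> run to infinity in the leaf, and the \<open>(k+1)\<close>-neighborhood of \<open>y k\<close> lies in the \<open>k\<close>-th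
  neighborhood of \<open>Y\<close>. A corona point where the extended bump function is positive therefore only
  accumulates on \<open>Y\<close>.
\<close>

lemma corona_open_limiting_to_minimal:
  assumes e: "e \<in> \<nu>L" and V: "openin K V" "e \<in> V"
  obtains Y U where "Y \<in> minimal_sets X n \<A>" "openin K U" "U \<inter> V \<inter> \<nu>L \<noteq> {}"
    "\<And>d. d \<in> U \<inter> \<nu>L \<Longrightarrow> leaf_limit X L K \<iota> d = Y"
proof -
  have eK: "e \<in> topspace K" using e by blast
  obtain Y where Y: "Y \<in> minimal_sets X n \<A>" "Y \<subseteq> leaf_limit X L K \<iota> e"
    using minimal_set_exists[OF leaf_limit_nonempty[OF eK] leaf_limit_saturated[OF e] leaf_limit_closed[OF eK]] .
  have Yne: "Y \<noteq> {}" and Ysat: "saturated X n \<A> Y" and Ycl: "closedin X Y"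
    and Ymin: "\<And>Z. Z \<noteq> {} \<Longrightarrow> saturated X n \<A> Z \<Longrightarrow> closedin X Z \<Longrightarrow> Z \<subseteq> Y \<Longrightarrow> Z = Y"
    using Y(1) by (simp_all add: minimal_sets_def)
  from closed_neighbourhood_sequence[OF X_regular second_countable Ycl] obtain N
    where "(\<forall>k::nat. openin X (N k) \<and> Y \<subseteq> N k) \<and> decseq N \<and> (\<Inter>k. X closure_of N k) \<subseteq> Y" ..
  then have N: "\<And>k. openin X (N k)" "\<And>k. Y \<subseteq> N k" "decseq N" "(\<Inter>k. X closure_of N k) \<subseteq> Y" by auto
  obtain p where p: "p \<in> L" using neighbourhood_meets_leaf[OF V] .
  have "regular_space K" using compact_Hausdorff_imp_regular_space K_compact K_Hausdorff .
  moreover have "closedin K (topspace K - V)" using V(1) by (intro closedin_diff) auto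
  moreover have "e \<in> topspace K - (topspace K - V)" using eK V(2) by blast
  \<comment> \<open>\<open>W\<close> has its closure inside \<open>V\<close>, since the corona point
    found below is only known to lie in the closure of the chosen leaf points.\<close>
  ultimately obtain W where W: "openin K W" "e \<in> W" "disjnt (topspace K - V) (K closure_of W)"
    using regular_space[THEN iffD1, rule_format, of K "topspace K - V" e] by blast
  have "\<forall>k. \<exists>y. y \<in> L \<and> \<iota> y \<in> W \<and> (p, y) \<notin> step ^^ k \<and> (step ^^ Suc k) `` {y} \<subseteq> N k"
    using leaf_point_near_saturated[OF e W(1,2) p Y(2) Yne Ysat N(1,2)] by blast
  from choice[OF this] obtain y where y: "\<And>k. y k \<in> L" "\<And>k. \<iota> (y k) \<in> W" "\<And>k. (p, y k) \<notin> step ^^ k"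
    "\<And>k. (step ^^ Suc k) `` {y k} \<subseteq> N k" by blast
  show thesis
  proof (rule smooth_bumps[of y, OF y(1)])
    fix h :: "'a \<Rightarrow> real"
    assume h: "continuous_map \<T> euclideanreal h" "\<And>x. x \<in> L \<Longrightarrow> 0 \<le> h x \<and> h x \<le> 1"
      "\<And>k. h (y k) \<ge> 1 - 1 / real (Suc k)"
      "\<And>x. x \<in> L \<Longrightarrow> h x > 0 \<Longrightarrow> \<exists>k. (y k, x) \<in> step ^^ Suc k"
      "\<And>R \<epsilon>. \<epsilon> > 0 \<Longrightarrow> \<exists>C. compactin \<T>\<^sub>L C \<and>
        (\<forall>x \<in> L - C. \<forall>z. (x, z) \<in> step ^^ R \<longrightarrow> \<bar>h x - h z\<bar> \<le> \<epsilon>)"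
    obtain H where H: "continuous_map K euclideanreal H" "\<And>x. x \<in> L \<Longrightarrow> H (\<iota> x) = h x"
      using slowly_varying_extends[OF h(1,2,5)] by blast
    define U where "U = {z \<in> topspace K. H z \<in> {0<..}}"
    have U: "openin K U" unfolding U_def by (rule openin_continuous_map_preimage[OF H(1)]) simp
    have limit: "leaf_limit X L K \<iota> d = Y" if d: "d \<in> U \<inter> \<nu>L" for d
    proof -
      have dK: "d \<in> topspace K" and d\<nu>: "d \<in> \<nu>L" and dU: "d \<in> U" using d by blast+
      have "leaf_limit X L K \<iota> d \<subseteq> X closure_of N m" for m
      proof -
        have "\<forall>k. \<exists>C. compactin \<T>\<^sub>L C \<and> (step ^^ Suc k) `` {y k} \<subseteq> C"
          using relpow_step_relatively_compact[OF leaf y(1)] by metis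
        from choice[OF this] obtain C where C: "\<And>k. compactin \<T>\<^sub>L (C k)"
          "\<And>k. (step ^^ Suc k) `` {y k} \<subseteq> C k" by blast
        \<comment> \<open>Deleting compact sets that contain the supports of index below
          \<open>m\<close> leaves only points in supports of index at least \<open>m\<close>, and
          these lie in \<open>N m\<close> because \<open>N\<close> decreases.\<close>
        let ?C = "\<Union>k<m. C k"
        have comp: "compactin \<T>\<^sub>L ?C" using C(1) by (intro compactin_Union) auto
        then have CL: "?C \<subseteq> L" using compactin_subset_topspace[OF comp] by simp
        have "openin K (U - \<iota> ` ?C)" using U \<iota>_image_closed[OF comp] by (rule openin_diff)
        moreover have "d \<in> U - \<iota> ` ?C" using d\<nu> dU CL by blast
        moreover have "{x \<in> L. \<iota> x \<in> U - \<iota> ` ?C} \<subseteq> N m"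
        proof clarify
          fix x assume x: "x \<in> L" "\<iota> x \<in> U" "\<iota> x \<notin> \<iota> ` ?C"
          have "h x > 0" using x(2) H(2)[OF x(1)] by (simp add: U_def)
          then obtain k where k: "(y k, x) \<in> step ^^ Suc k" using h(4)[OF x(1)] by blast
          then have "\<not> k < m" using x(3) C(2)[of k] by blast
          then show "x \<in> N m" using k y(4)[of k] decseqD[OF N(3), of m k] by auto
        qed
        then have "X closure_of {x \<in> L. \<iota> x \<in> U - \<iota> ` ?C} \<subseteq> X closure_of N m" by (rule closure_of_mono)
        ultimately show ?thesis using in_leaf_limit_iff[OF dK] by blast
      qed
      then have "leaf_limit X L K \<iota> d \<subseteq> Y" using N(4) by blast
      then show ?thesis
        by (rule Ymin[OF leaf_limit_nonempty[OF dK] leaf_limit_saturated[OF d\<nu>] leaf_limit_closed[OF dK]])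
    qed
    \<comment> \<open>Cluster points are expressed by nested closures of tails, because convergent
      subsequences need not exist in \<open>K\<close>.\<close>
    define A where "A m = K closure_of ((\<lambda>k. \<iota> (y k)) ` {m..})" for m
    have "(\<Inter>m. A m) \<noteq> {}"
    proof (rule compact_space_imp_nest[OF K_compact])
      show "closedin K (A m)" for m by (simp add: A_def)
      have "(\<lambda>k. \<iota> (y k)) ` {m..} \<subseteq> A m" for m
        unfolding A_def using \<iota>_in[OF y(1)] by (intro closure_of_subset) auto
      then show "A m \<noteq> {}" for m by blast
      show "decseq A" unfolding A_def decseq_def by (intro allI impI closure_of_mono image_mono) auto
    qed
    then obtain d where d: "\<And>m. d \<in> A m" by blast
    have dK: "d \<in> topspace K" using d[of 0] closure_of_subset_topspace[of K] unfolding A_def by (rule subsetD[rotated])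
    \<comment> \<open>A cluster point inside the leaf would have the image of a plaque as
      neighborhood, so points \<open>y k\<close> with arbitrarily large \<open>k\<close> would be
      within a fixed number of steps of \<open>p\<close>.\<close>
    have "d \<notin> \<iota> ` L"
    proof
      assume "d \<in> \<iota> ` L"
      then obtain q where q: "q \<in> L" "d = \<iota> q" by blast
      obtain a where a: "(p, q) \<in> step ^^ a" using leaf_chain[OF leaf p q(1)] .
      obtain P where P: "P \<in> plaque_family" "q \<in> P"
        using step_refl[OF L_subset[OF q(1)]] by (auto simp: step_iff_plaque_family)
      have "openin \<T>\<^sub>L (P \<inter> L)"
        by (rule openin_subtopology_Int[OF plaque_family_open[OF P(1)]])
      then have "openin K (\<iota> ` (P \<inter> L))" by (rule \<iota>_image_open)
      moreover have "d \<in> \<iota> ` (P \<inter> L)" using q P(2) by blast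
      ultimately have nb: "d \<in> \<iota> ` (P \<inter> L) \<and> openin K (\<iota> ` (P \<inter> L))" by (rule conjI[rotated])
      have "d \<in> K closure_of ((\<lambda>k. \<iota> (y k)) ` {Suc a..})" using d[of "Suc a"] by (simp add: A_def)
      from this[unfolded in_closure_of, THEN conjunct2, rule_format, OF nb]
      have "\<exists>z. z \<in> (\<lambda>k. \<iota> (y k)) ` {Suc a..} \<and> z \<in> \<iota> ` (P \<inter> L)" .
      then obtain k x where k: "Suc a \<le> k" "\<iota> (y k) = \<iota> x" "x \<in> P" "x \<in> L" by auto
      have "y k = x" by (rule inj_onD[OF \<iota>_inj k(2) y(1) k(4)])
      then have "(q, y k) \<in> step" using P k(3) step_iff_plaque_family by blast
      then have "(p, y k) \<in> step ^^ Suc a" using a by auto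
      from relpow_step_mono[OF this k(1) L_subset[OF p]] show False using y(3) by blast
    qed
    moreover have "d \<in> V"
    proof -
      have "A 0 \<subseteq> K closure_of W" unfolding A_def using y(2) by (intro closure_of_mono) auto
      then show ?thesis using d[of 0] dK W(3) by (auto simp: disjnt_iff)
    qed
    moreover have "d \<in> U"
    proof -
      \<comment> \<open>The tail starts at 1 because the lower bound for \<open>h (y 0)\<close> is
        only 0; from then on it is at least 1/2, and this closed condition passes to the cluster
        point.\<close>
      have "closedin K {z \<in> topspace K. H z \<in> {1/2..}}"
        by (rule closedin_continuous_map_preimage[OF H(1)]) simp
      moreover have "(\<lambda>k. \<iota> (y k)) ` {1..} \<subseteq> {z \<in> topspace K. H z \<in> {1/2..}}"
      proof clarify
        fix k :: nat assume "1 \<le> k"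
        then have "1 / real (Suc k) \<le> 1 / 2" by (intro divide_left_mono) auto
        then have "H (\<iota> (y k)) \<ge> 1 / 2" using h(3)[of k] unfolding H(2)[OF y(1)] by linarith
        then show "\<iota> (y k) \<in> topspace K \<and> H (\<iota> (y k)) \<in> {1/2..}" using \<iota>_in[OF y(1)] by simp
      qed
      ultimately have "A 1 \<subseteq> {z \<in> topspace K. H z \<in> {1/2..}}"
        unfolding A_def by (intro closure_of_minimal)
      then show ?thesis using d[of 1] dK by (auto simp: U_def)
    qed
    ultimately have "U \<inter> V \<inter> \<nu>L \<noteq> {}" using dK by blast
    then show thesis using that[OF Y(1) U _ limit] by blast
  qed
qed

lemma corona_limits_dense:
  "corona L K \<iota> closure_of
     (\<Union>Y \<in> minimal_sets X n \<A>. corona L K \<iota> interior_of (corona_limiting_to X L K \<iota> Y))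
   = topspace (corona L K \<iota>)"
proof (rule antisym[OF closure_of_subset_topspace], rule subsetI)
  let ?D = "\<Union>Y \<in> minimal_sets X n \<A>. corona L K \<iota> interior_of (corona_limiting_to X L K \<iota> Y)"
  have top: "topspace (corona L K \<iota>) = \<nu>L" by (auto simp: corona_def)
  fix e assume e: "e \<in> topspace (corona L K \<iota>)"
  show "e \<in> corona L K \<iota> closure_of ?D"
    unfolding in_closure_of
  proof (intro conjI allI impI)
    fix T assume T: "e \<in> T \<and> openin (corona L K \<iota>) T"
    then obtain V where V: "openin K V" "T = V \<inter> \<nu>L" unfolding corona_def openin_subtopology by blast
    have "e \<in> \<nu>L" "e \<in> V" using e T V(2) by (auto simp: top)
    from corona_open_limiting_to_minimal[OF this(1) V(1) this(2)]
    obtain Y U where Y: "Y \<in> minimal_sets X n \<A>" and U: "openin K U" "U \<inter> V \<inter> \<nu>L \<noteq> {}"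
      "\<And>d. d \<in> U \<inter> \<nu>L \<Longrightarrow> leaf_limit X L K \<iota> d = Y" by metis
    obtain d where d: "d \<in> U \<inter> V \<inter> \<nu>L" using U(2) by blast
    have "openin (corona L K \<iota>) (U \<inter> \<nu>L)" unfolding corona_def by (rule openin_subtopology_Int[OF U(1)])
    moreover have "U \<inter> \<nu>L \<subseteq> corona_limiting_to X L K \<iota> Y"
      using U(3) unfolding corona_limiting_to_def top by blast
    ultimately have "U \<inter> \<nu>L \<subseteq> corona L K \<iota> interior_of (corona_limiting_to X L K \<iota> Y)"
      by (rule interior_of_maximal[rotated])
    then have "d \<in> ?D" using d Y by blast
    then show "\<exists>d. d \<in> ?D \<and> d \<in> T" using d V(2) by blast
  qed (rule e)
qed

end

theorem theorem1p16:
  fixes X :: "'a topology" and n :: nat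
    and \<A> \<U> :: "('a, 'z) foliated_chart set"
    and L :: "'a set" and K :: "'k topology" and \<iota> :: "'a \<Rightarrow> 'k"
  assumes "compact_Polish_foliated_space X n \<A>"
    and "regular_foliated_atlas X n \<A> \<U>"
    and "L \<in> leaves X n \<A>"
    and "Higson_compactification X n \<A> \<U> L K \<iota>"
  shows "corona L K \<iota> closure_of
           (\<Union>Y \<in> minimal_sets X n \<A>. corona L K \<iota> interior_of (corona_limiting_to X L K \<iota> Y))
         = topspace (corona L K \<iota>)"
proof -
  interpret higson_leaf X n \<A> \<U> L K \<iota>
    using assms by unfold_locales (auto simp: compact_Polish_foliated_space_def)
  show ?thesis by (rule corona_limits_dense)
qed

end
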